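(* For every integer $n\ge1$, $$p^*(n)-2p_*(n)=\begin{cases}(-1)^j,&\text{if } n=3j^2+2j\ \text{ or }\ n=3j^2+4j+1\ \text{ for some integer } j\ge 0,\\ 0,&\text{otherwise.}\end{cases}$$
   Context: An overpartition of $n$ is a partition of $n$ (parts in decreasing order) in which the first appearance of each part size may or may not be overlined. $p^*(n)$ denotes the number of overpartitions of $n$ into non-negative parts (at least one part; the part $0$ is allowed) such that all even parts (including $0$) are overlined, and all odd parts less than twice the smallest part are overlined. Since only one copy of each part size can be overlined, even parts (including $0$) and odd parts less than twice the smallest part occur at most once each; odd parts greater than twice the smallest part may be repeated in non-overlined form, with at most one overlined copy of each size. Equivalently, $$\sum_{m\ge0}p^*(m)q^m=\sum_{n=0}^{\infty}\frac{(-q^{n+1};q)_\infty q^n}{(q^{2n+1};q^2)_\infty},$$ where $(a;q)_\infty=\prod_{m\ge0}(1-aq^m)$. For instance $p^*(5)=17$. $p_*(n)$ denotes the weighted number of partitions of $n$ into odd positive parts, where a partition with distinct part sizes $\lambda_k>\lambda_{k-1}>\cdots>\lambda_1$ is counted with weight $\prod_{i=1}^k w(\lambda_i)$, with $w(\lambda_i)=1+(\text{number of appearances of }\lambda_i)$ for $1\le i<k$, and $w(\lambda_k)=$ number of appearances of $\lambda_k$. For instance $p_*(5)=9$. *)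

theory Defs
  imports Complex_Main "HOL-Library.Multiset"
begin

text \<open>
  An overpartition is encoded as a pair \<open>(M, S)\<close>: \<open>M\<close> is the multiset of its parts
  (overlined or not) and \<open>S\<close> is the set of those part sizes whose first appearance is
  overlined. A partition in decreasing order is the same thing as the multiset of its parts.
\<close>

type_synonym overpartition = "nat multiset \<times> nat set"

definition overpartition_of :: "overpartition \<Rightarrow> nat \<Rightarrow> bool"
    (infix \<open>overpartition'_of\<close> 50) where
  "P overpartition_of n \<longleftrightarrow> sum_mset (fst P) = n \<and> snd P \<subseteq> set_mset (fst P)"

definition non_overlined :: "overpartition \<Rightarrow> nat multiset" where
  "non_overlined P = fst P - mset_set (snd P)"

definition smallest_part :: "overpartition \<Rightarrow> nat" where
  "smallest_part P = Min (set_mset (fst P))"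

text \<open>
  \<open>p_upper n\<close> is $p^*(n)$. That all parts of some kind are overlined is expressed by saying
  that no non-overlined part is of that kind. In particular the part \<open>0\<close> occurs at most
  once, so only finitely many overpartitions are counted.
\<close>

definition p_upper_set :: "nat \<Rightarrow> overpartition set" where
  "p_upper_set n = {P. P overpartition_of n \<and> fst P \<noteq> {#} \<and>
     (\<forall>k \<in># non_overlined P. \<not> even k) \<and>
     (\<forall>k \<in># non_overlined P. \<not> (odd k \<and> k < 2 * smallest_part P))}"

definition p_upper :: "nat \<Rightarrow> nat" where
  "p_upper n = card (p_upper_set n)"

definition odd_partitions :: "nat \<Rightarrow> nat multiset set" where
  "odd_partitions n = {M. sum_mset M = n \<and> (\<forall>k \<in># M. odd k)}"

definition part_weight :: "nat multiset \<Rightarrow> nat \<Rightarrow> nat" where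
  "part_weight M k = (if k = Max (set_mset M) then count M k else 1 + count M k)"

text \<open>\<open>p_lower n\<close> is $p_*(n)$.\<close>

definition p_lower :: "nat \<Rightarrow> nat" where
  "p_lower n = (\<Sum>M \<in> odd_partitions n. \<Prod>k \<in> set_mset M. part_weight M k)"

end

theory Submission
  imports Defs "HOL-Computational_Algebra.Formal_Laurent_Series"
begin

unbundle fps_syntax

text \<open>
  Write $(a;q)_n=\prod_{i<n}(1-aq^i)$, $\Theta=\sum_k(-1)^kq^{k(k+1)}$ and
  $F=\sum_k(-1)^kq^{3k^2+2k}(1+q^{2k+1})$. The coefficients of the false theta series $F$ are
  the right-hand side of the theorem. Let $P$ be the generating function of $p^*$ and
  $H=\sum_n q^{2n+1}/(q;q^2)_{n+1}^2$, whose coefficients in positive degree are those of $p_*$: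
  the summand with index $n$ collects the partitions with largest part $2n+1$. The claim is then
  $P-2H=F$. Both series are evaluated in terms of the same $\Theta$ and $F$:
  \[ P=2(-q;q)_\infty^2\,\Theta-F,\qquad H=(-q;q)_\infty^2\,\Theta-F, \]
  and the combination $P-2H$ eliminates the product.

  Each evaluation introduces a parameter $a$. For $P$, Euler's identity
  $(q;q^2)_\infty(-q;q)_\infty=1$ gives $P=2(-q;q)_\infty^2R(1)$, where
  \[ R(a)=\sum_n\frac{q^n(q;q^2)_n(-q;q)_n}{(-a;q)_{n+1}(-q/a;q)_n}. \]
  The sums $R(a)+aq^2R(aq^2)$ telescope in $n$ (\<open>upper_term_telescope\<close>), so
  $R(a)$ is an explicit term minus $aq^2R(aq^2)$. Iterating this from $a=1$ through $a=q^{2k}$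
  pushes the remainder to order $q^{K(K+1)}$ and leaves a sum over $k$, whose $k$-th term is
  $(-1)^kq^{k(k+1)}$ times one plus a boundary product; the products account for $F$ because
  $(-q^{2k};q)_\infty(-q^{1-2k};q)_\infty$ differs from its value at $k=0$ only by a power of $q$
  (\<open>qpoch_pair_shift\<close>). The series
  $\sum_n q^{2n+1}/\bigl((aq;q^2)_{n+1}(q/a;q^2)_{n+1}\bigr)$ treats $H$ in the same manner
  (\<open>lower_term_telescope\<close>). There the boundary products supply the terms of $\Theta$ two
  at a time and the elementary boundary terms supply $-F$.

  No infinite sum or product is formed. All identities are exact for sums over $n<N$ and $k<K$;
  they are then read modulo $q^M$ for $N$ and $K$ large. The ambient field is the field of formal
  Laurent series, since $q/a$ has a pole at $a=q^{2k}$.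
\<close>

section \<open>Finite \<open>q\<close>-shifted factorials\<close>

definition qpoch :: "'a::field \<Rightarrow> 'a \<Rightarrow> nat \<Rightarrow> 'a" where
  "qpoch a q n = (\<Prod>i<n. 1 - a * q ^ i)"

lemma qpoch_0 [simp]: "qpoch a q 0 = 1"
  by (simp add: qpoch_def)

lemma qpoch_Suc: "qpoch a q (Suc n) = qpoch a q n * (1 - a * q ^ n)"
  by (simp add: qpoch_def)

lemma qpoch_add: "qpoch a q (m + n) = qpoch a q m * qpoch (a * q ^ m) q n"
  by (induction n) (simp_all add: qpoch_Suc power_add mult_ac)

lemma qpoch_rec: "qpoch a q (Suc n) = (1 - a) * qpoch (a * q) q n"
  using qpoch_add[of a q 1 n] by (simp add: qpoch_Suc)

lemma qpoch_nonzero_iff: "qpoch a q n \<noteq> 0 \<longleftrightarrow> (\<forall>i<n. a * q ^ i \<noteq> 1)"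
  by (auto simp: qpoch_def)

text \<open>
  Reversing the order of the factors: the factor with exponent $-i$ in $(q^{1-j}/c;q)_j$ becomes,
  after multiplication by $-cq^i$, the factor $1-cq^i$ of $(c;q)_j$.
\<close>
lemma qpoch_reverse:
  assumes "c \<noteq> 0" "q \<noteq> 0"
  shows "(-c) ^ j * q ^ (j * (j - 1) div 2) * qpoch (q / (c * q ^ j)) q j = qpoch c q j"
proof (induction j)
  case (Suc j)
  have tri: "Suc j * (Suc j - 1) div 2 = j + j * (j - 1) div 2"
    using gauss_sum_nat[of j] gauss_sum_nat[of "j - 1"] by (cases j) (auto simp: algebra_simps)
  have *: "q / (c * q ^ Suc j) * q = q / (c * q ^ j)" using assms by (simp add: field_simps)
  have "qpoch (q / (c * q ^ Suc j)) q (Suc j) =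
      (1 - q / (c * q ^ Suc j)) * qpoch (q / (c * q ^ j)) q j"
    unfolding qpoch_rec * ..
  then have "(-c) ^ Suc j * q ^ (Suc j * (Suc j - 1) div 2) * qpoch (q / (c * q ^ Suc j)) q (Suc j)
     = ((-c) ^ j * q ^ (j * (j - 1) div 2) * qpoch (q / (c * q ^ j)) q j) *
       (- c * q ^ j * (1 - q / (c * q ^ Suc j)))"
    unfolding tri by (simp add: power_add mult_ac)
  also have "- c * q ^ j * (1 - q / (c * q ^ Suc j)) = 1 - c * q ^ j"
    using assms by (simp add: field_simps)
  finally show ?case unfolding Suc.IH qpoch_Suc by simp
qed simp

text \<open>
  Replacing $c$ by $cq^j$ in the theta-like product $(c;q)_m(q/c;q)_n$ moves $j$ factors from one
  side to the other at the cost of a monomial. This makes the boundary terms at $a=q^{2k}$ explicit;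
  it is used for $c=-1$ and, in base $q^2$, for $c=q$.
\<close>
lemma qpoch_pair_shift:
  assumes "c \<noteq> 0" "q \<noteq> 0" "j \<le> n"
  shows "(-c) ^ j * q ^ (j * (j - 1) div 2) *
      (qpoch (c * q ^ j) q m * qpoch (q / (c * q ^ j)) q n) =
    qpoch c q (m + j) * qpoch (q / c) q (n - j)"
proof -
  have "qpoch (q / (c * q ^ j)) q n = qpoch (q / (c * q ^ j)) q j * qpoch (q / c) q (n - j)"
    using qpoch_add[of "q / (c * q ^ j)" q j "n - j"] assms by simp
  moreover have "qpoch c q (m + j) = qpoch c q j * qpoch (c * q ^ j) q m"
    using qpoch_add[of c q j m] by (simp add: add.commute)
  ultimately show ?thesis
    using qpoch_reverse[OF assms(1,2), of j] by (simp add: mult_ac)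
qed

text \<open>
  A finite form of Euler's identity $(q;q^2)_\infty(-q;q)_\infty=1$. Both sides times $(q;q)_n$ are
  $(q;q)_{2n}$, split into odd and even factors on one side and into halves on the other.
\<close>
lemma qpoch_odd_times_qpoch_plus:
  assumes "qpoch q q n \<noteq> 0"
  shows "qpoch q (q\<^sup>2) n * qpoch (-q) q n = qpoch (q * q ^ n) q n"
proof -
  have 1: "qpoch q q n * qpoch (-q) q n = qpoch (q\<^sup>2) (q\<^sup>2) n"
    by (induction n) (simp_all add: qpoch_Suc power_mult[symmetric] algebra_simps power2_eq_square power_add mult_2)
  have 2: "qpoch q (q\<^sup>2) n * qpoch (q\<^sup>2) (q\<^sup>2) n = qpoch q q (n + n)"
    by (induction n) (simp_all add: qpoch_Suc power_mult[symmetric] algebra_simps power2_eq_square power_add mult_2)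
  have "qpoch q q n * (qpoch q (q\<^sup>2) n * qpoch (-q) q n) =
      qpoch q (q\<^sup>2) n * (qpoch q q n * qpoch (-q) q n)"
    by (simp only: mult_ac)
  also have "\<dots> = qpoch q q n * qpoch (q * q ^ n) q n"
    unfolding 1 2 by (rule qpoch_add)
  finally have "qpoch q q n * (qpoch q (q\<^sup>2) n * qpoch (-q) q n) = qpoch q q n * qpoch (q * q ^ n) q n" .
  with assms show ?thesis by simp
qed

section \<open>The telescoping series for overpartitions\<close>

text \<open>
  The general term of $R(a)$. At $a=1$ it is $q^n(q;q^2)_n/(2(-q;q)_n)$.
\<close>
definition upper_term :: "'a::field \<Rightarrow> 'a \<Rightarrow> nat \<Rightarrow> 'a" where
  "upper_term q a n = q ^ n * qpoch q (q\<^sup>2) n * qpoch (-q) q n / (qpoch (-a) q (Suc n) * qpoch (- q / a) q n)"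

text \<open>
  The antidifference of \<open>upper_term q a n + a * q\<^sup>2 * upper_term q (a * q\<^sup>2) n\<close>: a rational
  multiple of the term itself, as produced by creative telescoping.
\<close>
definition upper_cert :: "'a::field \<Rightarrow> 'a \<Rightarrow> nat \<Rightarrow> 'a" where
  "upper_cert q a n = - (a * (1 + a * q) * (1 + q ^ n / a) / ((1 + a * q ^ Suc n) * q ^ n)) * upper_term q a n"

text \<open>
  The shifted factorials at $aq^2$ and at $a$ share all but two factors at either end, so the ratio
  of the two terms is a rational function of $a$, $q$ and $q^n$.
\<close>
lemma upper_term_shift:
  fixes a q :: "'a::field"
  assumes a: "a \<noteq> 0" and q: "q \<noteq> 0"
    and nz1: "\<And>i. 1 + a * q ^ i \<noteq> 0" and nz2: "\<And>i. a + q ^ i \<noteq> 0"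
  shows "upper_term q (a * q\<^sup>2) n = upper_term q a n *
     ((a + q ^ n) * (a * q + q ^ n) / ((1 + a * q ^ Suc n) * (1 + a * q ^ Suc (Suc n))))"
proof -
  have d2: "qpoch (-q/a) q m \<noteq> 0" for m
  proof -
    have "- q / a * q ^ i \<noteq> 1" for i
    proof
      assume "- q / a * q ^ i = 1"
      then have "a + q ^ Suc i = 0" using a by (auto simp: field_simps)
      with nz2[of "Suc i"] show False by simp
    qed
    then show ?thesis by (simp add: qpoch_nonzero_iff)
  qed
  have e1: "qpoch (-(a * q\<^sup>2)) q (Suc n) * ((1 + a) * (1 + a * q)) =
     qpoch (-a) q (Suc n) * ((1 + a * q ^ Suc n) * (1 + a * q ^ Suc (Suc n)))"
  proof -
    have "(1 + a) * qpoch (- (a * q)) q (Suc n) = qpoch (-a) q (Suc n) * (1 + a * q ^ Suc n)"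
      using qpoch_rec[of "-a" q "Suc n"] qpoch_Suc[of "-a" q "Suc n"] by simp
    moreover have "(1 + a * q) * qpoch (- (a * q\<^sup>2)) q (Suc n) =
        qpoch (- (a * q)) q (Suc n) * (1 + a * q ^ Suc (Suc n))"
      using qpoch_rec[of "- (a * q)" q "Suc n"] qpoch_Suc[of "- (a * q)" q "Suc n"]
      by (simp add: power2_eq_square mult_ac)
    moreover have "x * (u * v) = z * (s * t)" if "u * y = z * s" "v * x = y * t" for x y z u v s t :: 'a
      using that by algebra
    ultimately show ?thesis by blast
  qed
  have e2: "qpoch (- q / (a * q\<^sup>2)) q n * ((1 + q ^ n / (a * q)) * (1 + q ^ n / a)) =
     qpoch (- q / a) q n * ((1 + 1 / (a * q)) * (1 + 1 / a))"
  proof -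
    have "qpoch (- q / (a * q\<^sup>2)) q (Suc (Suc n)) =
       (1 + 1 / (a * q)) * ((1 + 1/a) * qpoch (-q/a) q n)"
      using a q by (simp add: qpoch_rec field_simps power2_eq_square)
    moreover have "qpoch (- q / (a * q\<^sup>2)) q (Suc (Suc n)) =
       qpoch (- q / (a * q\<^sup>2)) q n * ((1 + q ^ n / (a * q)) * (1 + q ^ n / a))"
      using a q by (simp add: qpoch_Suc field_simps power2_eq_square)
    ultimately show ?thesis by (simp add: mult_ac)
  qed
  have nz: "1 + a \<noteq> 0" "1 + a * q \<noteq> 0" using nz1[of 0] nz1[of 1] by auto
  have nzq: "1 + 1 / a \<noteq> 0" "1 + 1 / (a * q) \<noteq> 0"
    using nz a q by (auto simp: field_simps add_eq_0_iff)
  have nzn: "1 + a * q ^ Suc n \<noteq> 0" "1 + a * q ^ Suc (Suc n) \<noteq> 0" using nz1 by blast+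
  have nza: "1 + q ^ n / a \<noteq> 0" using nz2[of n] a by (auto simp: field_simps add_eq_0_iff)
  have f1: "qpoch (-(a * q\<^sup>2)) q (Suc n) =
     qpoch (-a) q (Suc n) * ((1 + a * q ^ Suc n) * (1 + a * q ^ Suc (Suc n))) / ((1 + a) * (1 + a * q))"
    using e1 nz by (metis nonzero_eq_divide_eq mult_eq_0_iff)
  have g2: "qpoch (- q / (a * q\<^sup>2)) q n \<noteq> 0"
    using e2 d2[of n] nzq by (metis mult_eq_0_iff)
  have g1: "1 / qpoch (- q / (a * q\<^sup>2)) q n = ((1 + q ^ n / (a * q)) * (1 + q ^ n / a)) / 
     (qpoch (- q / a) q n * ((1 + 1 / (a * q)) * (1 + 1 / a)))"
  proof -
    have "qpoch (- q / a) q n * ((1 + 1 / (a * q)) * (1 + 1 / a)) \<noteq> 0"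
      using d2[of n] nzq by simp
    moreover have "1 / x = y / z" if "x * y = z" "z \<noteq> 0" for x y z :: 'a
      using that by auto
    ultimately show ?thesis using e2 by blast
  qed
  define A B where "A = qpoch (-a) q (Suc n)" and "B = qpoch (- q / a) q n"
  define W where "W = q ^ n * qpoch q (q\<^sup>2) n * qpoch (-q) q n"
  have "upper_term q (a * q\<^sup>2) n = W / qpoch (-(a * q\<^sup>2)) q (Suc n) * (1 / qpoch (- q / (a * q\<^sup>2)) q n)"
    by (simp add: upper_term_def W_def)
  also have "\<dots> = W / (A * ((1 + a * q ^ Suc n) * (1 + a * q ^ Suc (Suc n))) / ((1 + a) * (1 + a * q)))
       * (((1 + q ^ n / (a * q)) * (1 + q ^ n / a)) / (B * ((1 + 1 / (a * q)) * (1 + 1 / a))))"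
    unfolding f1 g1 A_def B_def ..
  also have "\<dots> = W / (A * B) * (((1 + a) * (1 + a * q) * ((1 + q ^ n / (a * q)) * (1 + q ^ n / a)))
      / (((1 + a * q ^ Suc n) * (1 + a * q ^ Suc (Suc n))) * ((1 + 1 / (a * q)) * (1 + 1 / a))))"
    by (simp add: mult_ac)
  also have "((1 + a) * (1 + a * q) * ((1 + q ^ n / (a * q)) * (1 + q ^ n / a)))
      / (((1 + a * q ^ Suc n) * (1 + a * q ^ Suc (Suc n))) * ((1 + 1 / (a * q)) * (1 + 1 / a)))
     = (a + q ^ n) * (a * q + q ^ n) / ((1 + a * q ^ Suc n) * (1 + a * q ^ Suc (Suc n)))"
  proof -
    have "(1 + a) = a * (1 + 1/a)" "1 + a * q = a * q * (1 + 1 / (a * q))"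
       "a + q ^ n = a * (1 + q ^ n / a)" "a * q + q ^ n = a * q * (1 + q ^ n / (a * q))"
      using a q by (simp_all add: field_simps)
    then have "(1 + a) * (1 + a * q) * ((1 + q ^ n / (a * q)) * (1 + q ^ n / a)) =
        (a + q ^ n) * (a * q + q ^ n) * ((1 + 1 / (a * q)) * (1 + 1 / a))"
      by (simp only: mult_ac)
    moreover have "(1 + 1 / (a * q)) * (1 + 1 / a) \<noteq> 0" using nzq by simp
    moreover have "x / (V * w) = y / V" if "x = y * w" "w \<noteq> 0" for x y V w :: 'a
      using that by simp
    ultimately show ?thesis by blast
  qed
  finally show ?thesis by (simp add: upper_term_def A_def B_def W_def)
qed

lemma upper_term_Suc:
  "upper_term q a (Suc n) = upper_term q a n *
     (q * (1 - q ^ (2 * n + 1)) * (1 + q ^ Suc n) / ((1 + a * q ^ Suc n) * (1 + q ^ Suc n / a)))"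
  unfolding upper_term_def qpoch_Suc[of _ _ n] qpoch_Suc[of "-a" _ "Suc n"]
  by (simp add: power_mult[symmetric] mult_ac)

text \<open>
  After division by the common term, the claim is a polynomial identity in $a$, $q$ and $Q=q^n$.
\<close>
lemma upper_term_telescope:
  fixes a q :: "'a::field"
  assumes a: "a \<noteq> 0" and q: "q \<noteq> 0"
    and nz1: "\<And>i. 1 + a * q ^ i \<noteq> 0" and nz2: "\<And>i. a + q ^ i \<noteq> 0"
  shows "upper_term q a n + a * q\<^sup>2 * upper_term q (a * q\<^sup>2) n = upper_cert q a (Suc n) - upper_cert q a n"
proof -
  define Q where "Q = q ^ n"
  define r where "r = upper_term q a n"
  define u where "u = 1 + a * q * Q"
  define v where "v = 1 + a * q\<^sup>2 * Q"
  define w where "w = 1 + q * Q / a"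
  have Q: "Q \<noteq> 0" using q by (simp add: Q_def)
  have u: "u \<noteq> 0" using nz1[of "Suc n"] by (simp add: u_def Q_def mult_ac)
  have v: "v \<noteq> 0" using nz1[of "Suc (Suc n)"] by (simp add: v_def Q_def mult_ac power2_eq_square)
  have w: "w \<noteq> 0" using nz2[of "Suc n"] a by (simp add: w_def Q_def field_simps)
  have L: "upper_term q a n + a * q\<^sup>2 * upper_term q (a * q\<^sup>2) n =
      r * (u * v + a * q\<^sup>2 * ((a + Q) * (a * q + Q))) / (u * v)"
  proof -
    have "upper_term q (a * q\<^sup>2) n = r * ((a + Q) * (a * q + Q) / (u * v))"
      unfolding upper_term_shift[OF a q nz1 nz2]
      by (simp add: r_def Q_def u_def v_def power2_eq_square mult_ac)
    moreover have "r + a * q\<^sup>2 * (r * (Z / (u * v))) = r * (u * v + a * q\<^sup>2 * Z) / (u * v)" for Z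
      using u v by (simp add: field_simps)
    ultimately show ?thesis by (simp add: r_def)
  qed
  have R1: "upper_cert q a (Suc n) = - (a * (1 + a * q)) * r * ((1 - q * Q\<^sup>2) * (1 + q * Q)) / (u * v * Q)"
  proof -
    have "upper_cert q a (Suc n) = - (a * (1 + a * q) * w / (v * (q * Q))) *
       (r * (q * (1 - q * Q\<^sup>2) * (1 + q * Q) / (u * w)))"
      unfolding upper_cert_def upper_term_Suc
      by (simp add: r_def Q_def u_def v_def w_def power2_eq_square power_add mult_ac mult_2 mult_2_right)
    also have "\<dots> = - (a * (1 + a * q)) * r * ((1 - q * Q\<^sup>2) * (1 + q * Q)) / (u * v * Q)"
      using w q Q u v by (simp add: field_simps)
    finally show ?thesis .
  qed
  have R2: "upper_cert q a n = - ((1 + a * q)) * r * ((a + Q) * v) / (u * v * Q)"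
  proof -
    have "upper_cert q a n = - (a * (1 + a * q) * (1 + Q / a) / (u * Q)) * r"
      by (simp add: upper_cert_def r_def Q_def u_def mult_ac)
    also have "\<dots> = - ((1 + a * q)) * r * ((a + Q) * v) / (u * v * Q)"
      using a Q u v by (simp add: field_simps)
    finally show ?thesis .
  qed
  have "(u * v + a * q\<^sup>2 * ((a + Q) * (a * q + Q))) * Q =
     - (a * (1 + a * q)) * ((1 - q * Q\<^sup>2) * (1 + q * Q)) + (1 + a * q) * ((a + Q) * v)"
    unfolding u_def v_def by algebra
  then have "r * (u * v + a * q\<^sup>2 * ((a + Q) * (a * q + Q))) * Q =
     - (a * (1 + a * q)) * r * ((1 - q * Q\<^sup>2) * (1 + q * Q)) - (- (1 + a * q) * r * ((a + Q) * v))"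
    by algebra
  moreover have "r * (u * v + a * q\<^sup>2 * ((a + Q) * (a * q + Q))) / (u * v) =
     r * (u * v + a * q\<^sup>2 * ((a + Q) * (a * q + Q))) * Q / (u * v * Q)"
    using Q by simp
  ultimately show ?thesis
    unfolding L R1 R2 diff_divide_distrib[symmetric] by simp
qed

lemma upper_term_sum_shift:
  fixes a q :: "'a::field"
  assumes a: "a \<noteq> 0" and q: "q \<noteq> 0"
    and nz1: "\<And>i. 1 + a * q ^ i \<noteq> 0" and nz2: "\<And>i. a + q ^ i \<noteq> 0"
  shows "(\<Sum>n<N. upper_term q a n) = 1 + upper_cert q a N - a * q\<^sup>2 * (\<Sum>n<N. upper_term q (a * q\<^sup>2) n)"
proof -
  have "(\<Sum>n<N. upper_term q a n) + a * q\<^sup>2 * (\<Sum>n<N. upper_term q (a * q\<^sup>2) n) =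
     (\<Sum>n<N. upper_cert q a (Suc n) - upper_cert q a n)"
    unfolding sum_distrib_left sum.distrib[symmetric] upper_term_telescope[OF assms] ..
  also have "\<dots> = upper_cert q a N - upper_cert q a 0" by (rule sum_lessThan_telescope)
  also have "upper_cert q a 0 = -1"
  proof -
    have "a * (1 + 1 / a) = 1 + a" using a by (simp add: field_simps)
    then have "a * (1 + a * q) * (1 + 1 / a) = (1 + a) * (1 + a * q)" by (simp add: mult_ac)
    then have "upper_cert q a 0 = - ((1 + a) / (1 + a))"
      unfolding upper_cert_def using nz1[of 1] by (simp add: upper_term_def qpoch_Suc del: minus_add_distrib)
    also have "(1 + a) / (1 + a) = 1" using nz1[of 0] by simp
    finally show ?thesis .
  qed
  finally show ?thesis by (simp add: algebra_simps)
qed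

section \<open>The telescoping series for odd partitions\<close>

text \<open>
  At $a=1$ this is $q^{2n+1}/(q;q^2)_{n+1}^2$.
\<close>
definition lower_term :: "'a::field \<Rightarrow> 'a \<Rightarrow> nat \<Rightarrow> 'a" where
  "lower_term q a n = q ^ (2 * n + 1) / (qpoch (a * q) (q\<^sup>2) (Suc n) * qpoch (q / a) (q\<^sup>2) (Suc n))"

text \<open>
  The antidifference of
  \<open>lower_term q a n + a ^ 3 * q ^ 3 * lower_term q (a * q\<^sup>2) n\<close>, again a rational multiple of
  \<open>lower_term q a n\<close>.
\<close>
definition lower_cert :: "'a::field \<Rightarrow> 'a \<Rightarrow> nat \<Rightarrow> 'a" where
  "lower_cert q a n = a * (1 - a\<^sup>2 * q\<^sup>2) / (qpoch (a * q) (q\<^sup>2) (Suc n) * qpoch (q / a) (q\<^sup>2) n)"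

lemma lower_term_shift:
  fixes a q :: "'a::field"
  assumes a: "a \<noteq> 0" and q: "q \<noteq> 0"
    and nz1: "\<And>i. 1 - a * q ^ (2 * i + 1) \<noteq> 0" and nz2: "\<And>i. a - q ^ (2 * i + 1) \<noteq> 0"
  shows "lower_term q (a * q\<^sup>2) n = - a * q * (lower_term q a n *
     ((1 - q ^ (2 * n + 1) / a) / (1 - a * q\<^sup>2 * q ^ (2 * n + 1))))"
proof -
  define X where "X = q ^ (2 * n + 1)"
  have X': "(q\<^sup>2) ^ n * q = X" by (simp add: X_def power_mult)
  have d2: "qpoch (q/a) (q\<^sup>2) m \<noteq> 0" for m
    using nz2 a by (auto simp: qpoch_nonzero_iff field_simps power_mult[symmetric])
  have e1: "qpoch (a * q\<^sup>2 * q) (q\<^sup>2) (Suc n) * (1 - a * q) = qpoch (a * q) (q\<^sup>2) (Suc n) * (1 - a * q\<^sup>2 * X)"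
  proof -
    have "a * q * (q\<^sup>2) ^ Suc n = a * q\<^sup>2 * X" by (simp add: X'[symmetric] mult_ac)
    moreover have "a * q * q\<^sup>2 = a * q\<^sup>2 * q" by (simp add: mult_ac)
    ultimately show ?thesis
      using qpoch_rec[of "a * q" "q\<^sup>2" "Suc n"] qpoch_Suc[of "a * q" "q\<^sup>2" "Suc n"]
      by (metis mult.commute)
  qed
  have e2: "qpoch (q / (a * q\<^sup>2)) (q\<^sup>2) (Suc n) * (1 - X / a) = qpoch (q / a) (q\<^sup>2) (Suc n) * (1 - 1 / (a * q))"
  proof -
    have "q / (a * q\<^sup>2) = 1 / (a * q)" "1 / (a * q) * q\<^sup>2 = q / a"
      using q a by (simp_all add: field_simps power2_eq_square)
    moreover have "q / a * (q\<^sup>2) ^ n = X / a" using X' by (simp add: mult_ac)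
    moreover have "1 / (a * q) * (q\<^sup>2) ^ Suc n = X / a" using q a by (simp add: X'[symmetric] field_simps power2_eq_square)
    ultimately show ?thesis
      using qpoch_rec[of "1 / (a * q)" "q\<^sup>2" "Suc n"] qpoch_Suc[of "1 / (a * q)" "q\<^sup>2" "Suc n"]
      by (simp add: mult_ac)
  qed
  have n1: "1 - a * q \<noteq> 0" using nz1[of 0] by simp
  have n2: "1 - 1 / (a * q) \<noteq> 0" using n1 a q by (simp add: field_simps)
  have n3: "1 - X / a \<noteq> 0" using nz2[of n] a by (simp add: X_def)
  have n4: "1 - a * q\<^sup>2 * X \<noteq> 0" using nz1[of "Suc n"] by (simp add: X_def power2_eq_square mult_ac)
  define A B where "A = qpoch (a * q) (q\<^sup>2) (Suc n)" and "B = qpoch (q / a) (q\<^sup>2) (Suc n)"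
  have f1: "qpoch (a * q\<^sup>2 * q) (q\<^sup>2) (Suc n) = A * (1 - a * q\<^sup>2 * X) / (1 - a * q)"
    using e1 n1 by (simp add: A_def field_simps)
  have f2: "qpoch (q / (a * q\<^sup>2)) (q\<^sup>2) (Suc n) = B * (1 - 1 / (a * q)) / (1 - X / a)"
    using e2 n3 by (simp only: B_def nonzero_eq_divide_eq not_False_eq_True)
  have c: "(1 - a * q) / (1 - 1 / (a * q)) = - a * q"
    using n2 a q by (simp add: divide_eq_eq) (simp add: field_simps)
  have "lower_term q (a * q\<^sup>2) n = X / (A * (1 - a * q\<^sup>2 * X) / (1 - a * q) * (B * (1 - 1 / (a * q)) / (1 - X / a)))"
    unfolding lower_term_def f1 f2 X_def ..
  also have "\<dots> = (1 - a * q) / (1 - 1 / (a * q)) * (X / (A * B) * ((1 - X / a) / (1 - a * q\<^sup>2 * X)))"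
    by (simp add: mult_ac)
  finally show ?thesis unfolding c lower_term_def A_def B_def X_def by simp
qed

lemma lower_term_telescope:
  fixes a q :: "'a::field"
  assumes a: "a \<noteq> 0" and q: "q \<noteq> 0"
    and nz1: "\<And>i. 1 - a * q ^ (2 * i + 1) \<noteq> 0" and nz2: "\<And>i. a - q ^ (2 * i + 1) \<noteq> 0"
  shows "lower_term q a n + a ^ 3 * q ^ 3 * lower_term q (a * q\<^sup>2) n = lower_cert q a (Suc n) - lower_cert q a n"
proof -
  define X where "X = q ^ (2 * n + 1)"
  define A B where "A = qpoch (a * q) (q\<^sup>2) (Suc n)" and "B = qpoch (q / a) (q\<^sup>2) (Suc n)"
  define v where "v = 1 - a * q\<^sup>2 * X"
  have d1: "A \<noteq> 0" using nz1 unfolding A_def 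
    by (auto simp: qpoch_nonzero_iff field_simps power_mult[symmetric])
  have d2: "qpoch (q/a) (q\<^sup>2) m \<noteq> 0" for m
    using nz2 a by (auto simp: qpoch_nonzero_iff field_simps power_mult[symmetric])
  have B: "B \<noteq> 0" unfolding B_def by (rule d2)
  have X': "(q\<^sup>2) ^ n * q = X" by (simp add: X_def power_mult)
  have X: "X \<noteq> 0" using q by (simp add: X_def)
  have v: "v \<noteq> 0" using nz1[of "Suc n"] by (simp add: v_def X_def power2_eq_square mult_ac)
  have n3: "1 - X / a \<noteq> 0" using nz2[of n] a by (simp add: X_def)
  have "qpoch (q / a) (q\<^sup>2) n * (1 - X / a) = B"
    using X' by (simp add: B_def qpoch_Suc mult_ac)
  then have C: "qpoch (q / a) (q\<^sup>2) n = B / (1 - X / a)" using n3 by (simp add: field_simps)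
  have D: "qpoch (a * q) (q\<^sup>2) (Suc (Suc n)) = A * v"
    using X' unfolding qpoch_Suc[of _ _ "Suc n"] A_def v_def by (simp add: mult_ac power2_eq_square)
  have h: "lower_term q a n = X / (A * B)" by (simp add: lower_term_def X_def A_def B_def)
  have L: "lower_term q a n + a ^ 3 * q ^ 3 * lower_term q (a * q\<^sup>2) n =
     (X * v - a ^ 4 * q ^ 4 * X * (1 - X / a)) / (A * B * v)"
    unfolding lower_term_shift[OF assms] h X_def[symmetric] v_def[symmetric] using v d1 B
    by (simp add: field_simps eval_nat_numeral)
  have R1: "lower_cert q a (Suc n) = a * (1 - a\<^sup>2 * q\<^sup>2) / (A * B * v)"
    unfolding lower_cert_def D B_def by (simp add: mult_ac)
  have R2: "lower_cert q a n = a * (1 - a\<^sup>2 * q\<^sup>2) * (1 - X / a) * v / (A * B * v)"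
    unfolding lower_cert_def C A_def[symmetric] using v by simp
  have "X * v - a ^ 4 * q ^ 4 * X * (1 - X / a) = 
    a * (1 - a\<^sup>2 * q\<^sup>2) - a * (1 - a\<^sup>2 * q\<^sup>2) * (1 - X / a) * v"
    using a unfolding v_def by (simp add: field_simps eval_nat_numeral)
  then show ?thesis unfolding L R1 R2 diff_divide_distrib[symmetric] by simp
qed

lemma lower_term_sum_shift:
  fixes a q :: "'a::field"
  assumes a: "a \<noteq> 0" and q: "q \<noteq> 0"
    and nz1: "\<And>i. 1 - a * q ^ (2 * i + 1) \<noteq> 0" and nz2: "\<And>i. a - q ^ (2 * i + 1) \<noteq> 0"
  shows "(\<Sum>n<N. lower_term q a n) = lower_cert q a N - a * (1 + a * q) - a ^ 3 * q ^ 3 * (\<Sum>n<N. lower_term q (a * q\<^sup>2) n)"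
proof -
  have "(\<Sum>n<N. lower_term q a n) + a ^ 3 * q ^ 3 * (\<Sum>n<N. lower_term q (a * q\<^sup>2) n) =
     (\<Sum>n<N. lower_cert q a (Suc n) - lower_cert q a n)"
    unfolding sum_distrib_left sum.distrib[symmetric] lower_term_telescope[OF assms] ..
  also have "\<dots> = lower_cert q a N - lower_cert q a 0" by (rule sum_lessThan_telescope)
  also have "lower_cert q a 0 = a * (1 + a * q)"
  proof -
    have "1 - a\<^sup>2 * q\<^sup>2 = (1 + a * q) * (1 - a * q)" by (simp add: power2_eq_square algebra_simps)
    then show ?thesis using nz1[of 0] by (simp add: lower_cert_def qpoch_Suc)
  qed
  finally show ?thesis by (simp add: algebra_simps)
qed

section \<open>Congruences between formal Laurent series\<close>

text \<open>
  Membership in the fractional ideal $q^M\,\mathbb{Q}[[q]]$. For $M=0$ it says that a Laurent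
  series is a power series.
\<close>
definition vanishes_below :: "nat \<Rightarrow> rat fls \<Rightarrow> bool" where
  "vanishes_below M f \<longleftrightarrow> (\<forall>i<int M. f $$ i = 0)"

lemma vanishes_below_simps [simp]:
  "vanishes_below M 0"
  "vanishes_below 0 1"
  "vanishes_below M (- f) \<longleftrightarrow> vanishes_below M f"
  "vanishes_below 0 (numeral k)"
  by (auto simp: vanishes_below_def)

lemma vanishes_below_mono: "vanishes_below M f \<Longrightarrow> L \<le> M \<Longrightarrow> vanishes_below L f"
  by (auto simp: vanishes_below_def)

lemma vanishes_below_add: "vanishes_below M f \<Longrightarrow> vanishes_below M g \<Longrightarrow> vanishes_below M (f + g)"
  by (auto simp: vanishes_below_def)

lemma vanishes_below_diff: "vanishes_below M f \<Longrightarrow> vanishes_below M g \<Longrightarrow> vanishes_below M (f - g)"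
  by (auto simp: vanishes_below_def)

lemma vanishes_below_sum: "(\<And>x. x \<in> A \<Longrightarrow> vanishes_below M (f x)) \<Longrightarrow> vanishes_below M (sum f A)"
  by (auto simp: vanishes_below_def fls_nth_sum)

lemma vanishes_below_mult_add:
  assumes "vanishes_below M f" "vanishes_below L g"
  shows "vanishes_below (M + L) (f * g)"
proof (cases "f = 0 \<or> g = 0")
  case False
  then have "int M \<le> fls_subdegree f" "int L \<le> fls_subdegree g"
    using assms by (auto intro!: fls_subdegree_geI simp: vanishes_below_def)
  then show ?thesis
    unfolding vanishes_below_def by (auto intro!: fls_times_nth_eq0)
qed auto

lemma vanishes_below_mult:
  "vanishes_below M f \<Longrightarrow> vanishes_below 0 g \<Longrightarrow> vanishes_below M (f * g)"
  "vanishes_below 0 f \<Longrightarrow> vanishes_below M g \<Longrightarrow> vanishes_below M (f * g)"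
  using vanishes_below_mult_add[of M f 0 g] vanishes_below_mult_add[of 0 f M g] by auto

lemma vanishes_below_prod: "(\<And>x. x \<in> A \<Longrightarrow> vanishes_below 0 (f x)) \<Longrightarrow> vanishes_below 0 (prod f A)"
  by (induction A rule: infinite_finite_induct) (auto intro!: vanishes_below_mult)

lemma vanishes_below_X_power: "M \<le> n \<Longrightarrow> vanishes_below M (fls_X ^ n)"
  by (auto simp: vanishes_below_def)

lemma vanishes_below_power: "vanishes_below 0 f \<Longrightarrow> vanishes_below 0 (f ^ n)"
  by (induction n) (auto intro: vanishes_below_mult)

text \<open>
  The series $f$ may have a pole here: a nonzero coefficient at $q^0$ already forces the order of
  $f$ to be at most $0$. This applies to $1+q^i$ for every integer $i$, and so disposes of all
  factors of $(-q/a;q)_n$ at $a=q^{2k}$ at once.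
\<close>
lemma vanishes_below_inverse: "f $$ 0 \<noteq> 0 \<Longrightarrow> vanishes_below 0 (inverse f)"
proof -
  assume "f $$ 0 \<noteq> 0"
  then have "fls_subdegree f \<le> 0" by (rule fls_subdegree_leI)
  then have "0 \<le> fls_subdegree (inverse f)" by simp
  then show ?thesis by (auto simp: vanishes_below_def)
qed

lemma vanishes_below_divide:
  "vanishes_below M f \<Longrightarrow> g $$ 0 \<noteq> 0 \<Longrightarrow> vanishes_below M (f / g)"
  unfolding divide_inverse by (intro vanishes_below_mult vanishes_below_inverse)

text \<open>
  Congruence modulo $q^M$. It is compatible with products only as long as the factors are power
  series, which is why integrality is a side condition below.
\<close>
definition eqmod :: "nat \<Rightarrow> rat fls \<Rightarrow> rat fls \<Rightarrow> bool" where
  "eqmod M f g \<longleftrightarrow> vanishes_below M (f - g)"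

lemma eqmod_nth: "eqmod M f g \<Longrightarrow> m < M \<Longrightarrow> f $$ int m = g $$ int m"
  by (auto simp: eqmod_def vanishes_below_def)

lemma eqmod_refl [simp]: "eqmod M f f"
  by (simp add: eqmod_def)

lemma eqmod_sym: "eqmod M f g \<Longrightarrow> eqmod M g f"
  by (auto simp: eqmod_def vanishes_below_def)

lemma eqmod_trans [trans]: "eqmod M f g \<Longrightarrow> eqmod M g h \<Longrightarrow> eqmod M f h"
  by (auto simp: eqmod_def vanishes_below_def)

lemma eqmod_add: "eqmod M f f' \<Longrightarrow> eqmod M g g' \<Longrightarrow> eqmod M (f + g) (f' + g')"
  by (auto simp: eqmod_def vanishes_below_def)

lemma eqmod_diff: "eqmod M f f' \<Longrightarrow> eqmod M g g' \<Longrightarrow> eqmod M (f - g) (f' - g')"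
  by (auto simp: eqmod_def vanishes_below_def)

lemma eqmod_sum: "(\<And>x. x \<in> A \<Longrightarrow> eqmod M (f x) (g x)) \<Longrightarrow> eqmod M (sum f A) (sum g A)"
  unfolding eqmod_def sum_subtractf[symmetric] by (rule vanishes_below_sum)

lemma eqmod_mult:
  assumes "eqmod M f f'" "eqmod M g g'" "vanishes_below 0 f" "vanishes_below 0 g'"
  shows "eqmod M (f * g) (f' * g')"
proof -
  have "f * g - f' * g' = f * (g - g') + (f - f') * g'" by (simp add: algebra_simps)
  then show ?thesis
    using assms unfolding eqmod_def
    by (metis vanishes_below_add vanishes_below_mult)
qed

lemma eqmod_mult_left: "eqmod M g g' \<Longrightarrow> vanishes_below 0 f \<Longrightarrow> eqmod M (f * g) (f * g')"
  unfolding eqmod_def right_diff_distrib[symmetric] by (rule vanishes_below_mult)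

lemma integral_times_nth_0:
  assumes "vanishes_below 0 f" "vanishes_below 0 g"
  shows "(f * g) $$ 0 = f $$ 0 * g $$ 0"
proof -
  have c: "vanishes_below 0 (fls_const c)" for c by (auto simp: vanishes_below_def)
  have "eqmod 1 h (fls_const (h $$ 0))" if "vanishes_below 0 h" for h
    using that by (auto simp: eqmod_def vanishes_below_def)
  then have "eqmod 1 (f * g) (fls_const (f $$ 0) * fls_const (g $$ 0))"
    using assms c by (intro eqmod_mult) auto
  from eqmod_nth[OF this, of 0] show ?thesis by simp
qed

lemma eqmod_inverse:
  assumes "eqmod M f g" "f $$ 0 \<noteq> 0" "g $$ 0 \<noteq> 0"
  shows "eqmod M (inverse f) (inverse g)"
proof -
  have "f \<noteq> 0" "g \<noteq> 0" using assms by auto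
  then have "inverse f - inverse g = (g - f) * (inverse f * inverse g)" by (simp add: field_simps)
  moreover have "vanishes_below M (g - f)" using eqmod_sym[OF assms(1)] by (simp add: eqmod_def)
  ultimately show ?thesis
    using assms unfolding eqmod_def by (metis vanishes_below_mult(1) vanishes_below_inverse)
qed

lemma eqmod_divide:
  assumes "eqmod M f f'" "eqmod M g g'" "vanishes_below 0 f" "g $$ 0 \<noteq> 0" "g' $$ 0 \<noteq> 0"
  shows "eqmod M (f / g) (f' / g')"
  unfolding divide_inverse
  using assms by (intro eqmod_mult eqmod_inverse vanishes_below_inverse)

lemma eqmod_qpoch_1:
  assumes "vanishes_below s a" "vanishes_below 0 q"
  shows "eqmod s (qpoch a q n) 1"
proof (induction n)
  case (Suc n)
  have "vanishes_below s (a * q ^ n)" by (intro vanishes_below_mult assms vanishes_below_power)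
  then have "eqmod s (1 - a * q ^ n) 1" by (simp add: eqmod_def)
  moreover have "vanishes_below 0 (1 - a * q ^ n)"
    using \<open>vanishes_below s (a * q ^ n)\<close> by (intro vanishes_below_diff) (auto intro: vanishes_below_mono)
  ultimately have "eqmod s (qpoch a q n * (1 - a * q ^ n)) (1 * 1)"
    using Suc assms unfolding qpoch_def
    by (intro eqmod_mult) 
     (auto intro!: vanishes_below_prod vanishes_below_diff vanishes_below_mult vanishes_below_power
           intro: vanishes_below_mono[OF assms(1)])
  then show ?case by (simp add: qpoch_Suc)
qed simp

lemma qpoch_integral:
  assumes "vanishes_below 0 a" "vanishes_below 0 q"
  shows "vanishes_below 0 (qpoch a q n)"
  unfolding qpoch_def
  by (intro vanishes_below_prod vanishes_below_diff vanishes_below_mult vanishes_below_power assms) auto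

lemma qpoch_nth_0:
  assumes "vanishes_below 1 a" "vanishes_below 0 q"
  shows "qpoch a q n $$ 0 = 1"
  using eqmod_nth[OF eqmod_qpoch_1[OF assms, of n], of 0] by simp

section \<open>The products of Euler modulo a power of \<open>q\<close>\<close>

abbreviation q :: "rat fls" where "q \<equiv> fls_X"

definition plus_poch :: "nat \<Rightarrow> rat fls" where "plus_poch n = qpoch (-q) q n"
definition odd_poch :: "nat \<Rightarrow> rat fls" where "odd_poch n = qpoch q (q\<^sup>2) n"

lemma vanishes_X [simp]: "vanishes_below 0 q" "vanishes_below 1 q" "vanishes_below (Suc 0) q" "vanishes_below 0 (q ^ n)"
  by (auto simp: vanishes_below_def)

lemma plus_poch_nth_0 [simp]: "plus_poch n $$ 0 = 1"
  and odd_poch_nth_0 [simp]: "odd_poch n $$ 0 = 1"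
  unfolding plus_poch_def odd_poch_def by (intro qpoch_nth_0; simp)+

lemma plus_poch_integral [simp]: "vanishes_below 0 (plus_poch n)"
  and odd_poch_integral [simp]: "vanishes_below 0 (odd_poch n)"
  unfolding plus_poch_def odd_poch_def by (intro qpoch_integral; simp)+

lemma plus_poch_nonzero [simp]: "plus_poch n \<noteq> 0"
  and odd_poch_nonzero [simp]: "odd_poch n \<noteq> 0"
  using plus_poch_nth_0[of n] odd_poch_nth_0[of n] by (metis fls_zero_nth zero_neq_one)+

lemma plus_poch_stable: "M \<le> n \<Longrightarrow> eqmod M (plus_poch n) (plus_poch M)"
proof -
  assume "M \<le> n"
  have "vanishes_below M (- q * q ^ M)"
    by (auto intro!: vanishes_below_mult vanishes_below_X_power)
  then have "eqmod M (plus_poch M * qpoch (- q * q ^ M) q (n - M)) (plus_poch M * 1)"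
    by (intro eqmod_mult_left eqmod_qpoch_1) auto
  then show ?thesis
    using qpoch_add[of "-q" q M "n - M"] \<open>M \<le> n\<close> by (simp add: plus_poch_def)
qed

lemma odd_poch_stable: "M \<le> n \<Longrightarrow> eqmod M (odd_poch n) (odd_poch M)"
proof -
  assume "M \<le> n"
  have "vanishes_below M (q * (q\<^sup>2) ^ M)"
    unfolding power_mult[symmetric] by (intro vanishes_below_mult vanishes_below_X_power) auto
  then have "eqmod M (odd_poch M * qpoch (q * (q\<^sup>2) ^ M) (q\<^sup>2) (n - M)) (odd_poch M * 1)"
    by (intro eqmod_mult_left eqmod_qpoch_1) auto
  then show ?thesis
    using qpoch_add[of q "q\<^sup>2" M "n - M"] \<open>M \<le> n\<close> by (simp add: odd_poch_def)
qed

lemma odd_poch_times_plus_poch: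
  assumes "M \<le> m" "M \<le> n"
  shows "eqmod M (odd_poch m * plus_poch n) 1"
proof -
  have "qpoch q q M $$ 0 = 1" by (rule qpoch_nth_0) auto
  then have "qpoch q q M \<noteq> 0" by (metis fls_zero_nth zero_neq_one)
  then have "odd_poch M * plus_poch M = qpoch (q * q ^ M) q M"
    unfolding odd_poch_def plus_poch_def by (rule qpoch_odd_times_qpoch_plus)
  moreover have "eqmod M (qpoch (q * q ^ M) q M) 1"
    by (intro eqmod_qpoch_1 vanishes_below_mult vanishes_below_X_power) auto
  moreover have "eqmod M (odd_poch m * plus_poch n) (odd_poch M * plus_poch M)"
    using assms by (intro eqmod_mult plus_poch_stable odd_poch_stable) auto
  ultimately show ?thesis by (metis eqmod_trans)
qed

section \<open>Iteration along even powers of \<open>q\<close>\<close>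

lemma X_power_add_nonzero: "q ^ i + q ^ j \<noteq> 0"
proof
  assume "q ^ i + q ^ j = 0"
  then have "(q ^ i + q ^ j) $$ int i = 0" by simp
  then show False by (auto split: if_splits)
qed

lemma X_power_diff_nonzero: "i \<noteq> j \<Longrightarrow> q ^ i - q ^ j \<noteq> 0"
proof
  assume "q ^ i - q ^ j = 0" "i \<noteq> j"
  then have "(q ^ i - q ^ j) $$ int i = 0" by simp
  then show False using \<open>i \<noteq> j\<close> by (auto split: if_splits)
qed

lemma X_power_divide: "q ^ i / q ^ j = fls_X_intpow (int i - int j)"
proof -
  have "q ^ i / q ^ j = q powi (int i - int j)"
    by (simp add: power_int_diff del: fls_X_power_int)
  then show ?thesis by simp
qed

lemma integral_inverse_qpoch:
  assumes "\<And>i. (1 - a * x ^ i) $$ 0 \<noteq> 0"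
  shows "vanishes_below 0 (inverse (qpoch a x n))"
  unfolding qpoch_def prod_inversef[symmetric] comp_def
  by (intro vanishes_below_prod vanishes_below_inverse assms)

lemma upper_term_integral: "vanishes_below 0 (upper_term q (q ^ (2 * k)) n)"
proof -
  have "vanishes_below 0 (inverse (qpoch (- (q ^ (2 * k))) q (Suc n)))"
  proof (rule integral_inverse_qpoch)
    show "(1 - - (q ^ (2 * k)) * q ^ i) $$ 0 \<noteq> 0" for i
      by (simp add: power_add[symmetric])
  qed
  moreover have "vanishes_below 0 (inverse (qpoch (- q / q ^ (2 * k)) q n))"
  proof (rule integral_inverse_qpoch)
    show "(1 - - q / q ^ (2 * k) * q ^ i) $$ 0 \<noteq> 0" for i
    proof -
      have "- q / q ^ (2 * k) * q ^ i = - fls_X_intpow (int (Suc i) - int (2 * k))"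
        unfolding X_power_divide[symmetric]
        by (simp only: power_Suc times_divide_eq_left minus_divide_left mult_minus_left)
      then have "(1 - - q / q ^ (2 * k) * q ^ i) $$ 0 = 1 + fls_X_intpow (int (Suc i) - int (2 * k)) $$ 0"
        by (simp only: fls_minus_nth fls_uminus_nth fls_one_nth) simp
      then show ?thesis by simp
    qed
  qed
  ultimately show ?thesis
    unfolding upper_term_def divide_inverse inverse_mult_distrib
      odd_poch_def[symmetric] plus_poch_def[symmetric]
    by (intro vanishes_below_mult) simp_all
qed

lemma lower_term_integral: "vanishes_below 0 (lower_term q (q ^ (2 * k)) n)"
proof -
  have "vanishes_below 0 (inverse (qpoch (q ^ (2 * k) * q) (q\<^sup>2) (Suc n)))"
  proof (rule integral_inverse_qpoch)
    show "(1 - q ^ (2 * k) * q * (q\<^sup>2) ^ i) $$ 0 \<noteq> 0" for i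
    proof -
      have "q ^ (2 * k) * q * (q\<^sup>2) ^ i = q ^ (2 * k + 1 + 2 * i)"
        by (simp add: power_add power_mult)
      then have "(1 - q ^ (2 * k) * q * (q\<^sup>2) ^ i) $$ 0 = 1 - (q ^ (2 * k + 1 + 2 * i)) $$ 0"
        by (simp only: fls_minus_nth fls_one_nth) simp
      then show ?thesis by (simp only: fls_X_power_nth) simp
    qed
  qed
  moreover have "vanishes_below 0 (inverse (qpoch (q / q ^ (2 * k)) (q\<^sup>2) (Suc n)))"
  proof (rule integral_inverse_qpoch)
    show "(1 - q / q ^ (2 * k) * (q\<^sup>2) ^ i) $$ 0 \<noteq> 0" for i
    proof -
      have "q / q ^ (2 * k) * (q\<^sup>2) ^ i = fls_X_intpow (int (2 * i + 1) - int (2 * k))"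
        unfolding X_power_divide[symmetric]
        by (simp only: power_add power_mult power_one_right times_divide_eq_left mult.commute[of q])
      then have "(1 - q / q ^ (2 * k) * (q\<^sup>2) ^ i) $$ 0 = 1 - fls_X_intpow (int (2 * i + 1) - int (2 * k)) $$ 0"
        by (simp only: fls_minus_nth fls_one_nth) simp
      then show ?thesis by simp presburger
    qed
  qed
  ultimately show ?thesis
    unfolding lower_term_def divide_inverse inverse_mult_distrib
    by (intro vanishes_below_mult vanishes_X)
qed

text \<open>
  The weight of the $k$-th step is $\prod_{i<k}(-q^{2i}q^2)=(-1)^kq^{k(k+1)}$.
\<close>
lemma upper_term_sum_iterate:
  "(\<Sum>n<N. upper_term q 1 n) =
     (\<Sum>k<K. (-1) ^ k * q ^ (k * (k + 1)) * (1 + upper_cert q (q ^ (2 * k)) N)) +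
     (-1) ^ K * q ^ (K * (K + 1)) * (\<Sum>n<N. upper_term q (q ^ (2 * K)) n)"
proof (induction K)
  case (Suc K)
  have shift: "(\<Sum>n<N. upper_term q (q ^ (2 * K)) n) = 1 + upper_cert q (q ^ (2 * K)) N -
     q ^ (2 * K) * q\<^sup>2 * (\<Sum>n<N. upper_term q (q ^ (2 * K) * q\<^sup>2) n)"
  proof (rule upper_term_sum_shift)
    show "1 + q ^ (2 * K) * q ^ i \<noteq> 0" for i
      using X_power_add_nonzero[of 0 "2 * K + i"] by (simp add: power_add)
    show "q ^ (2 * K) + q ^ i \<noteq> 0" for i by (rule X_power_add_nonzero)
  qed auto
  have e: "Suc K * (Suc K + 1) = K * (K + 1) + (2 * K + 2)" by simp
  have p: "q ^ (Suc K * (Suc K + 1)) = q ^ (K * (K + 1)) * (q ^ (2 * K) * q\<^sup>2)"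
    unfolding e power_add[symmetric] ..
  have "q ^ (2 * K) * q\<^sup>2 = q ^ (2 * Suc K)" by (simp add: power_add[symmetric])
  then show ?case
    unfolding Suc.IH shift p by (simp add: algebra_simps)
qed simp

text \<open>
  The weight of the $k$-th step is $\prod_{i<k}(-q^{6i}q^3)=(-1)^kq^{3k^2}$.
\<close>
lemma lower_term_sum_iterate:
  "(\<Sum>n<N. lower_term q 1 n) =
     (\<Sum>k<K. (-1) ^ k * q ^ (3 * k\<^sup>2) * (lower_cert q (q ^ (2 * k)) N - q ^ (2 * k) * (1 + q ^ (2 * k) * q))) +
     (-1) ^ K * q ^ (3 * K\<^sup>2) * (\<Sum>n<N. lower_term q (q ^ (2 * K)) n)"
proof (induction K)
  case (Suc K)
  have shift: "(\<Sum>n<N. lower_term q (q ^ (2 * K)) n) = lower_cert q (q ^ (2 * K)) N -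
     q ^ (2 * K) * (1 + q ^ (2 * K) * q) - (q ^ (2 * K)) ^ 3 * q ^ 3 * (\<Sum>n<N. lower_term q (q ^ (2 * K) * q\<^sup>2) n)"
  proof (rule lower_term_sum_shift)
    show "1 - q ^ (2 * K) * q ^ (2 * i + 1) \<noteq> 0" for i
      using X_power_diff_nonzero[of 0 "2 * K + (2 * i + 1)"] unfolding power_add[symmetric] by simp
    show "q ^ (2 * K) - q ^ (2 * i + 1) \<noteq> 0" for i
      by (rule X_power_diff_nonzero) presburger
  qed auto
  have e: "3 * (Suc K)\<^sup>2 = 3 * K\<^sup>2 + (2 * K * 3 + 3)" by (simp add: power2_eq_square algebra_simps)
  have p: "q ^ (3 * (Suc K)\<^sup>2) = q ^ (3 * K\<^sup>2) * ((q ^ (2 * K)) ^ 3 * q ^ 3)"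
    unfolding e power_add[symmetric] power_mult[symmetric] ..
  have "q ^ (2 * K) * q\<^sup>2 = q ^ (2 * Suc K)" by (simp add: power_add[symmetric])
  then show ?case
    unfolding Suc.IH shift p by (simp add: algebra_simps)
qed simp

text \<open>
  The boundary term at $a=q^{2k}$ in closed form. The exponent $3k^2+2k$ of the false theta series
  arises as $k(k+1)+2k+k(2k-1)$: the weight of the iteration, the factor $a$ of the certificate, and
  the monomial of \<open>qpoch_pair_shift\<close>.
\<close>
lemma upper_cert_eval:
  assumes "2 * k \<le> N"
  shows "q ^ (k * (k + 1)) * upper_cert q (q ^ (2 * k)) N =
    - (q ^ (3 * k\<^sup>2 + 2 * k) * (1 + q ^ (2 * k + 1)) *
      (((1 + q ^ (N - 2 * k)) / (1 + q ^ (2 * k + Suc N))) * (odd_poch N * plus_poch N) /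
       (2 * plus_poch (N + 2 * k) * plus_poch (N - 2 * k))))"
proof -
  define D where "D = qpoch (- (q ^ (2 * k))) q (Suc N) * qpoch (- q / q ^ (2 * k)) q N"
  define P where "P = 2 * plus_poch (N + 2 * k) * plus_poch (N - 2 * k)"
  have P: "P \<noteq> 0" by (simp add: P_def)
  have "q ^ (k * (2 * k - 1)) * D = P"
  proof -
    have "2 * k * (2 * k - 1) div 2 = k * (2 * k - 1)" by simp
    moreover have "q / (- 1 * q ^ (2 * k)) = - q / q ^ (2 * k)"
      by (simp only: mult_minus1 minus_divide_left[symmetric] minus_divide_right[symmetric])
    moreover have "qpoch (- 1) q (Suc N + 2 * k) = 2 * plus_poch (N + 2 * k)"
      by (simp add: qpoch_rec plus_poch_def)
    moreover have "qpoch (q / - 1) q (N - 2 * k) = plus_poch (N - 2 * k)"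
      by (simp add: plus_poch_def)
    ultimately show ?thesis
      using qpoch_pair_shift[of "-1" q "2 * k" N "Suc N"] assms
      by (simp add: D_def P_def)
  qed
  then have D: "1 / D = q ^ (k * (2 * k - 1)) / P" using P by auto
  have c: "q ^ N / q ^ (2 * k) = q ^ (N - 2 * k)"
    using assms by (simp add: power_diff)
  have "upper_term q (q ^ (2 * k)) N = q ^ N * (odd_poch N * plus_poch N) * (1 / D)"
    by (simp add: upper_term_def D_def odd_poch_def plus_poch_def mult_ac)
  then have r: "upper_term q (q ^ (2 * k)) N = q ^ N * (odd_poch N * plus_poch N) * (q ^ (k * (2 * k - 1)) / P)"
    unfolding D .
  have e: "k * (k + 1) + 2 * k + k * (2 * k - 1) = 3 * k\<^sup>2 + 2 * k"
    by (cases k) (auto simp: power2_eq_square algebra_simps)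
  have p: "q ^ (3 * k\<^sup>2 + 2 * k) = q ^ (k * (k + 1)) * q ^ (2 * k) * q ^ (k * (2 * k - 1))"
    unfolding e[symmetric] power_add ..
  have gen: "x * (- (a * y * z / (w * n)) * (n * op * (b / P))) = - (x * a * b * y * (z / w * op / P))"
    if "n \<noteq> 0" for x a y z w n op b :: "rat fls"
    using that by simp
  have s: "q ^ (2 * k) * q = q ^ (2 * k + 1)" "q ^ (2 * k) * q ^ Suc N = q ^ (2 * k + Suc N)"
    by (simp_all add: power_add)
  show ?thesis
    unfolding upper_cert_def r c p s P_def[symmetric] by (rule gen) simp
qed

lemma eqmod_1_divide:
  assumes "vanishes_below M x" "vanishes_below M y" "M \<ge> 1"
  shows "eqmod M ((1 + x) / (1 + y)) 1"
proof -
  have "x $$ 0 = 0" "y $$ 0 = 0" using assms by (auto simp: vanishes_below_def)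
  moreover have "vanishes_below 0 x" using assms by (auto intro: vanishes_below_mono)
  ultimately have "eqmod M ((1 + x) / (1 + y)) (1 / 1)"
    using assms by (intro eqmod_divide vanishes_below_add) (auto simp: eqmod_def)
  then show ?thesis by simp
qed

text \<open>
  In the closed form the quotient of the two factors $1+q^{N-2k}$, $1+q^{2k+N+1}$ and the product
  $(q;q^2)_N(-q;q)_N$ are congruent to $1$, and multiplication by $2(-q;q)_M^2$ cancels the
  denominator.
\<close>
lemma upper_cert_eqmod:
  assumes "2 * k + M \<le> N" "M \<ge> 1"
  shows "eqmod M (2 * (plus_poch M)\<^sup>2 * (q ^ (k * (k + 1)) * upper_cert q (q ^ (2 * k)) N))
     (- (q ^ (3 * k\<^sup>2 + 2 * k) * (1 + q ^ (2 * k + 1))))"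
proof -
  define E where "E = (1 + q ^ (N - 2 * k)) / (1 + q ^ (2 * k + Suc N))"
  define R where "R = ((plus_poch M * plus_poch M) / (plus_poch (N + 2 * k) * plus_poch (N - 2 * k)))"
  define W where "W = q ^ (3 * k\<^sup>2 + 2 * k) * (1 + q ^ (2 * k + 1))"
  have "vanishes_below M (q ^ (N - 2 * k))" "vanishes_below M (q ^ (2 * k + Suc N))"
    using assms by (auto intro!: vanishes_below_X_power simp del: power_Suc)
  then have E: "eqmod M E 1" unfolding E_def using assms by (intro eqmod_1_divide)
  have "eqmod M R ((plus_poch M * plus_poch M) / (plus_poch M * plus_poch M))"
    unfolding R_def using assms
    by (intro eqmod_divide eqmod_mult plus_poch_stable) (auto intro: vanishes_below_mult simp: integral_times_nth_0)
  then have R: "eqmod M R 1" by simp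
  have iR: "vanishes_below 0 R" unfolding R_def
    by (intro vanishes_below_divide vanishes_below_mult) (auto simp: integral_times_nth_0)
  have E': "eqmod M (odd_poch N * plus_poch N) 1" using assms by (intro odd_poch_times_plus_poch) auto
  have "eqmod M (R * (odd_poch N * plus_poch N * E)) (1 * (1 * 1))"
    by (intro eqmod_mult R E E' iR vanishes_below_mult) auto
  moreover have "vanishes_below 0 (- W)" unfolding W_def
    by (auto intro!: vanishes_below_mult vanishes_below_add simp del: power_Suc)
  ultimately have "eqmod M (- W * (R * (odd_poch N * plus_poch N * E))) (- W * (1 * (1 * 1)))"
    by (rule eqmod_mult_left)
  moreover have "2 * (plus_poch M)\<^sup>2 * (q ^ (k * (k + 1)) * upper_cert q (q ^ (2 * k)) N) =
     - W * (R * (odd_poch N * plus_poch N * E))"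
    unfolding upper_cert_eval[OF order_trans[OF le_add1 assms(1)]] R_def
    unfolding W_def[symmetric] E_def[symmetric] by (simp add: power2_eq_square mult_ac)
  ultimately show ?thesis by (simp add: W_def)
qed

lemma lower_cert_eval:
  assumes "k \<le> N"
  shows "lower_cert q (q ^ (2 * k)) N =
    (-1) ^ k * q ^ (k\<^sup>2 + 2 * k) * (1 - q ^ (4 * k + 2)) / (odd_poch (N + 1 + k) * odd_poch (N - k))"
proof -
  define D where "D = qpoch (q ^ (2 * k) * q) (q\<^sup>2) (Suc N) * qpoch (q / q ^ (2 * k)) (q\<^sup>2) N"
  define P where "P = odd_poch (N + 1 + k) * odd_poch (N - k)"
  have P: "P \<noteq> 0" by (simp add: P_def)
  have "(-1) ^ k * q ^ (k\<^sup>2) * D = P"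
  proof -
    have sq: "x\<^sup>2 / (y * x) = x / y" "x\<^sup>2 / x = x" if "x \<noteq> 0" for x y :: "rat fls"
      using that by (simp_all add: power2_eq_square)
    have e1: "q * (q\<^sup>2) ^ k = q ^ (2 * k) * q" by (simp add: power_mult)
    have e2: "q\<^sup>2 / (q ^ (2 * k) * q) = q / q ^ (2 * k)" "q\<^sup>2 / q = q"
      by (rule sq; simp)+
    have e3: "(- q) ^ k * (q\<^sup>2) ^ (k * (k - 1) div 2) = (-1) ^ k * q ^ (k\<^sup>2)"
    proof -
      have "k + 2 * (k * (k - 1) div 2) = k\<^sup>2"
        by (cases k) (auto simp: power2_eq_square)
      then show ?thesis unfolding power_minus[of q] power_mult[symmetric] mult.assoc power_add[symmetric] by simp
    qed
    have e4: "Suc N + k = N + 1 + k" by simp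
    show ?thesis
      using qpoch_pair_shift[OF _ _ assms, of q "q\<^sup>2" "Suc N"]
      unfolding D_def P_def odd_poch_def e1 e2 e3 e4 by simp
  qed
  then have "1 / D = (-1) ^ k * q ^ (k\<^sup>2) / P" using P by auto
  moreover have "lower_cert q (q ^ (2 * k)) N = q ^ (2 * k) * (1 - q ^ (4 * k + 2)) * (1 / D)"
    by (simp add: lower_cert_def D_def power_mult[symmetric] power_add[symmetric])
  ultimately show ?thesis by (simp add: P_def power_add)
qed

text \<open>
  The signs of the weight and of the monomial cancel, and the exponents $3k^2$, $k^2+2k$ add up to
  $2k(2k+1)$. The factor $1-q^{4k+2}$ then yields two consecutive terms of $\Theta$.
\<close>
lemma lower_cert_eqmod:
  assumes "k + M \<le> N" "M \<ge> 1"
  shows "eqmod M ((-1) ^ k * q ^ (3 * k\<^sup>2) * lower_cert q (q ^ (2 * k)) N)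
     ((plus_poch M)\<^sup>2 * (q ^ (2 * k * (2 * k + 1)) - q ^ ((2 * k + 1) * (2 * k + 2))))"
proof -
  define W where "W = q ^ (2 * k * (2 * k + 1)) - q ^ ((2 * k + 1) * (2 * k + 2))"
  define R where "R = 1 / (odd_poch (N + 1 + k) * odd_poch (N - k))"
  have "eqmod M R ((odd_poch (N + 1 + k) * plus_poch M * (odd_poch (N - k) * plus_poch M)) / (odd_poch (N + 1 + k) * odd_poch (N - k)))"
    unfolding R_def
  proof (intro eqmod_divide)
    have "eqmod M (odd_poch (N + 1 + k) * plus_poch M * (odd_poch (N - k) * plus_poch M)) (1 * 1)"
      using assms by (intro eqmod_mult odd_poch_times_plus_poch) (auto intro: vanishes_below_mult)
    then show "eqmod M 1 (odd_poch (N + 1 + k) * plus_poch M * (odd_poch (N - k) * plus_poch M))"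
      by (simp add: eqmod_sym)
  qed (auto simp: integral_times_nth_0)
  then have "eqmod M R ((plus_poch M)\<^sup>2)" by (simp add: power2_eq_square mult_ac)
  moreover have "vanishes_below 0 W" unfolding W_def by (intro vanishes_below_diff vanishes_X)
  ultimately have "eqmod M (W * R) (W * (plus_poch M)\<^sup>2)" by (rule eqmod_mult_left)
  moreover have "(-1) ^ k * q ^ (3 * k\<^sup>2) * lower_cert q (q ^ (2 * k)) N = W * R"
  proof -
    have "2 * k * (2 * k + 1) = 3 * k\<^sup>2 + (k\<^sup>2 + 2 * k)"
       "(2 * k + 1) * (2 * k + 2) = 3 * k\<^sup>2 + (k\<^sup>2 + 2 * k) + (4 * k + 2)"
      by (simp_all add: power2_eq_square algebra_simps)
    then have W: "W = q ^ (3 * k\<^sup>2) * (q ^ (k\<^sup>2 + 2 * k) * (1 - q ^ (4 * k + 2)))"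
      unfolding W_def by (simp only: power_add right_diff_distrib mult_ac mult_1_right mult_1_left)
    have "(-1) ^ k * ((-1) ^ k :: rat fls) = 1" by (simp add: power_mult_distrib[symmetric])
    then show ?thesis using assms unfolding W R_def by (simp add: lower_cert_eval)
  qed
  ultimately show ?thesis by (simp add: W_def mult_ac)
qed

section \<open>The identity between the generating functions\<close>

definition theta_sum :: "nat \<Rightarrow> rat fls" where
  "theta_sum K = (\<Sum>k<K. (-1) ^ k * q ^ (k * (k + 1)))"

definition false_theta_sum :: "nat \<Rightarrow> rat fls" where
  "false_theta_sum K = (\<Sum>k<K. (-1) ^ k * q ^ (3 * k\<^sup>2 + 2 * k) * (1 + q ^ (2 * k + 1)))"

lemma minus_one_power_integral [simp]: "vanishes_below 0 ((-1) ^ k)"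
  by (intro vanishes_below_power) simp

lemma theta_sum_stable:
  assumes "M \<le> K"
  shows "eqmod M (theta_sum K) (theta_sum M)"
proof -
  have "theta_sum K - theta_sum M = (\<Sum>k\<in>{..<K} - {..<M}. (-1) ^ k * q ^ (k * (k + 1)))"
    unfolding theta_sum_def using assms by (intro sum_diff[symmetric]) auto
  also have "vanishes_below M \<dots>"
  proof (intro vanishes_below_sum vanishes_below_mult(2) vanishes_below_X_power minus_one_power_integral)
    fix k assume "k \<in> {..<K} - {..<M}"
    then show "M \<le> k * (k + 1)" by (cases k) auto
  qed
  finally show ?thesis by (simp add: eqmod_def)
qed

lemma theta_sum_pairs:
  "theta_sum (2 * K) = (\<Sum>k<K. q ^ (2 * k * (2 * k + 1)) - q ^ ((2 * k + 1) * (2 * k + 2)))"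
  by (induction K) (simp_all add: theta_sum_def)

lemma upper_term_sum_eqmod:
  assumes "3 * M \<le> N" "M \<ge> 1"
  shows "eqmod M (2 * (plus_poch M)\<^sup>2 * (\<Sum>n<N. upper_term q 1 n))
     (2 * (plus_poch M)\<^sup>2 * theta_sum M - false_theta_sum M)"
proof -
  let ?c = "2 * (plus_poch M)\<^sup>2"
  define Rem where "Rem = (-1) ^ M * q ^ (M * (M + 1)) * (\<Sum>n<N. upper_term q (q ^ (2 * M)) n)"
  have c: "vanishes_below 0 ?c" by (intro vanishes_below_mult vanishes_below_power) auto
  have "M \<le> M * (M + 1)" by simp
  then have "vanishes_below M Rem" unfolding Rem_def
    by (intro vanishes_below_mult(1) vanishes_below_mult(2)[of "(-1) ^ M"] vanishes_below_sum upper_term_integral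
        vanishes_below_X_power minus_one_power_integral)
  then have Rem: "eqmod M (?c * Rem) 0"
    using c by (auto simp: eqmod_def intro: vanishes_below_mult)
  have "eqmod M (?c * (q ^ (k * (k + 1)) * upper_cert q (q ^ (2 * k)) N))
     (- (q ^ (3 * k\<^sup>2 + 2 * k) * (1 + q ^ (2 * k + 1))))" if "k < M" for k
    using that assms by (intro upper_cert_eqmod) auto
  then have "eqmod M (\<Sum>k<M. (-1) ^ k * (?c * (q ^ (k * (k + 1)) * upper_cert q (q ^ (2 * k)) N)))
     (\<Sum>k<M. (-1) ^ k * (- (q ^ (3 * k\<^sup>2 + 2 * k) * (1 + q ^ (2 * k + 1)))))"
    by (intro eqmod_sum eqmod_mult_left) auto
  then have "eqmod M (?c * theta_sum M + (\<Sum>k<M. (-1) ^ k * (?c * (q ^ (k * (k + 1)) * upper_cert q (q ^ (2 * k)) N))) + ?c * Rem)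
      (?c * theta_sum M + (\<Sum>k<M. (-1) ^ k * (- (q ^ (3 * k\<^sup>2 + 2 * k) * (1 + q ^ (2 * k + 1))))) + 0)"
    by (intro eqmod_add Rem eqmod_refl)
  moreover have "?c * (\<Sum>n<N. upper_term q 1 n) =
     ?c * theta_sum M + (\<Sum>k<M. (-1) ^ k * (?c * (q ^ (k * (k + 1)) * upper_cert q (q ^ (2 * k)) N))) + ?c * Rem"
    unfolding upper_term_sum_iterate[of N M] Rem_def[symmetric] theta_sum_def
    by (simp add: distrib_left sum.distrib sum_distrib_left mult_ac)
  moreover have "(\<Sum>k<M. (-1) ^ k * (- (q ^ (3 * k\<^sup>2 + 2 * k) * (1 + q ^ (2 * k + 1))))) = - false_theta_sum M"
    by (simp add: false_theta_sum_def sum_negf mult_ac)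
  ultimately show ?thesis by simp
qed

lemma lower_term_sum_eqmod:
  assumes "3 * M \<le> N" "M \<ge> 1"
  shows "eqmod M (\<Sum>n<N. lower_term q 1 n) ((plus_poch M)\<^sup>2 * theta_sum M - false_theta_sum M)"
proof -
  let ?c = "(plus_poch M)\<^sup>2"
  define Rem where "Rem = (-1) ^ M * q ^ (3 * M\<^sup>2) * (\<Sum>n<N. lower_term q (q ^ (2 * M)) n)"
  have c: "vanishes_below 0 ?c" by (intro vanishes_below_power) auto
  have "M \<le> 3 * M\<^sup>2" by (simp add: power2_eq_square)
  then have "vanishes_below M Rem" unfolding Rem_def
    by (intro vanishes_below_mult(1) vanishes_below_mult(2)[of "(-1) ^ M"] vanishes_below_sum lower_term_integral
        vanishes_below_X_power minus_one_power_integral)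
  then have Rem: "eqmod M Rem 0" by (simp add: eqmod_def)
  have "eqmod M (\<Sum>k<M. (-1) ^ k * q ^ (3 * k\<^sup>2) * lower_cert q (q ^ (2 * k)) N)
     (\<Sum>k<M. ?c * (q ^ (2 * k * (2 * k + 1)) - q ^ ((2 * k + 1) * (2 * k + 2))))"
    using assms by (intro eqmod_sum lower_cert_eqmod) auto
  also have "(\<Sum>k<M. ?c * (q ^ (2 * k * (2 * k + 1)) - q ^ ((2 * k + 1) * (2 * k + 2)))) = ?c * theta_sum (2 * M)"
    by (simp only: theta_sum_pairs sum_distrib_left)
  also have "eqmod M \<dots> (?c * theta_sum M)"
    by (intro eqmod_mult_left theta_sum_stable c) simp
  finally have "eqmod M ((\<Sum>k<M. (-1) ^ k * q ^ (3 * k\<^sup>2) * lower_cert q (q ^ (2 * k)) N) - false_theta_sum M + Rem)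
      (?c * theta_sum M - false_theta_sum M + 0)"
    by (intro eqmod_add eqmod_diff Rem eqmod_refl)
  moreover have "(\<Sum>n<N. lower_term q 1 n) = (\<Sum>k<M. (-1) ^ k * q ^ (3 * k\<^sup>2) * lower_cert q (q ^ (2 * k)) N) - false_theta_sum M + Rem"
  proof -
    have "(-1) ^ k * q ^ (3 * k\<^sup>2) * (lower_cert q (q ^ (2 * k)) N - q ^ (2 * k) * (1 + q ^ (2 * k) * q)) =
      (-1) ^ k * q ^ (3 * k\<^sup>2) * lower_cert q (q ^ (2 * k)) N - (-1) ^ k * q ^ (3 * k\<^sup>2 + 2 * k) * (1 + q ^ (2 * k + 1))" for k
      by (simp add: power_add algebra_simps)
    then show ?thesis
      unfolding lower_term_sum_iterate[of N M] Rem_def[symmetric] false_theta_sum_def sum_subtractf[symmetric] by simp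
  qed
  ultimately show ?thesis by simp
qed

text \<open>
  The coefficients of $(-q;q)_\infty^2\Theta$ in the two evaluations are $2$ and $1$, those of $F$
  are $-1$ and $-1$; hence only $-F+2F=F$ survives.
\<close>
lemma generating_function_identity:
  assumes "3 * M \<le> N" "M \<ge> 1"
  shows "eqmod M ((\<Sum>n<N. q ^ n * (plus_poch N / plus_poch n) * (odd_poch n / odd_poch N))
       - 2 * (\<Sum>n<N. q ^ (2 * n + 1) / (odd_poch (Suc n))\<^sup>2)) (false_theta_sum M)"
proof -
  let ?c = "(plus_poch M)\<^sup>2"
  have MN: "M \<le> N" using assms by simp
  have c: "2 * ?c * upper_term q 1 n = q ^ n * (plus_poch M * odd_poch n / plus_poch n) * plus_poch M" for n
  proof -
    have "qpoch (- 1) q (Suc n) = 2 * plus_poch n" by (simp add: qpoch_rec plus_poch_def)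
    then show ?thesis
      unfolding power2_eq_square[of "plus_poch M"]
      by (simp add: upper_term_def odd_poch_def[symmetric] plus_poch_def[symmetric])
  qed
  have "eqmod M (plus_poch N / odd_poch N * 1) (plus_poch M / odd_poch N * (odd_poch N * plus_poch M))"
    using MN by (intro eqmod_mult eqmod_divide plus_poch_stable eqmod_refl eqmod_sym[OF odd_poch_times_plus_poch] vanishes_below_divide vanishes_below_mult)
      auto
  then have pp: "eqmod M (plus_poch N / odd_poch N) (?c)"
    by (simp add: power2_eq_square)
  have "eqmod M (\<Sum>n<N. (q ^ n * (odd_poch n / plus_poch n)) * (plus_poch N / odd_poch N)) (\<Sum>n<N. (q ^ n * (odd_poch n / plus_poch n)) * ?c)"
    by (intro eqmod_sum eqmod_mult_left pp vanishes_below_mult vanishes_below_divide) auto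
  also have "(\<Sum>n<N. (q ^ n * (odd_poch n / plus_poch n)) * ?c) = 2 * ?c * (\<Sum>n<N. upper_term q 1 n)"
    unfolding sum_distrib_left c by (simp add: power2_eq_square mult_ac)
  also have "eqmod M \<dots> (2 * ?c * theta_sum M - false_theta_sum M)"
    using assms by (rule upper_term_sum_eqmod)
  finally have P: "eqmod M (\<Sum>n<N. q ^ n * (plus_poch N / plus_poch n) * (odd_poch n / odd_poch N)) (2 * ?c * theta_sum M - false_theta_sum M)"
    by (simp add: mult_ac)
  have "eqmod M (2 * (\<Sum>n<N. lower_term q 1 n)) (2 * (?c * theta_sum M - false_theta_sum M))"
    using assms by (intro eqmod_mult_left lower_term_sum_eqmod) auto
  also have "(\<Sum>n<N. lower_term q 1 n) = (\<Sum>n<N. q ^ (2 * n + 1) / (odd_poch (Suc n))\<^sup>2)"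
    by (simp add: lower_term_def odd_poch_def power2_eq_square)
  finally have "eqmod M ((\<Sum>n<N. q ^ n * (plus_poch N / plus_poch n) * (odd_poch n / odd_poch N)) - 2 * (\<Sum>n<N. q ^ (2 * n + 1) / (odd_poch (Suc n))\<^sup>2))
     ((2 * ?c * theta_sum M - false_theta_sum M) - 2 * (?c * theta_sum M - false_theta_sum M))"
    by (intro eqmod_diff P)
  then show ?thesis by (simp add: algebra_simps)
qed

section \<open>Products as generating functions of weighted partitions\<close>

text \<open>
  The generating function of the multiplicities of a single part size \<open>k\<close>, multiplicity
  \<open>c\<close> having weight \<open>v c\<close>.
\<close>
definition part_gf :: "(nat \<Rightarrow> 'a) \<Rightarrow> nat \<Rightarrow> 'a::comm_ring_1 fps" where
  "part_gf v k = Abs_fps (\<lambda>i. if k dvd i then v (i div k) else 0)"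

lemma finite_multisets_of_sum:
  assumes "0 \<notin> A"
  shows "finite {M::nat multiset. set_mset M \<subseteq> A \<and> sum_mset M = m}"
proof (rule finite_subset)
  show "{M::nat multiset. set_mset M \<subseteq> A \<and> sum_mset M = m} \<subseteq> mset ` {xs. set xs \<subseteq> {..m} \<and> length xs \<le> m}"
  proof
    fix M :: "nat multiset" assume M: "M \<in> {M. set_mset M \<subseteq> A \<and> sum_mset M = m}"
    obtain xs where xs: "mset xs = M" using ex_mset by blast
    have "k \<le> m" if "k \<in># M" for k
      using M that by (auto dest!: multi_member_split)
    moreover have "size M \<le> sum_mset M"
    proof -
      have "0 \<notin># M" using M assms by auto
      then show ?thesis by (induction M) auto
    qed
    ultimately show "M \<in> mset ` {xs. set xs \<subseteq> {..m} \<and> length xs \<le> m}"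
      using xs M by (intro image_eqI[of _ _ xs]) (auto simp flip: set_mset_mset size_mset)
  qed
  show "finite (mset ` {xs. set xs \<subseteq> {..m} \<and> length xs \<le> m})"
    by (intro finite_imageI finite_lists_length_le) auto
qed

text \<open>
  Induction on the set of part sizes: splitting off all copies of the new size \<open>a\<close> turns
  the Cauchy product into a sum over the pairs of a multiplicity and a partition without \<open>a\<close>.
\<close>
lemma fps_nth_prod_part_gf:
  assumes "finite A" "0 \<notin> A"
  shows "fps_nth (\<Prod>k\<in>A. part_gf (w k) k) m =
    (\<Sum>M | set_mset M \<subseteq> A \<and> sum_mset M = m. \<Prod>k\<in>A. w k (count M k))"
  using assms
proof (induction A arbitrary: m rule: finite_induct)
  case empty
  have "{M::nat multiset. set_mset M \<subseteq> {} \<and> sum_mset M = m} = (if m = 0 then {{#}} else {})" by auto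
  then show ?case by simp
next
  case (insert a A)
  define B where "B c = {M::nat multiset. set_mset M \<subseteq> A \<and> sum_mset M = m - c * a}" for c
  have a: "a > 0" "0 \<notin> A" using insert.prems by (auto intro: gr0I)
  have "fps_nth (\<Prod>k\<in>insert a A. part_gf (w k) k) m =
      (\<Sum>i=0..m. (if a dvd i then w a (i div a) else 0) *
         (\<Sum>M | set_mset M \<subseteq> A \<and> sum_mset M = m - i. \<Prod>k\<in>A. w k (count M k)))"
    using insert a by (simp add: fps_mult_nth part_gf_def[of _ a])
  also have "\<dots> = (\<Sum>i\<in>{i\<in>{0..m}. a dvd i}. w a (i div a) *
         (\<Sum>M | set_mset M \<subseteq> A \<and> sum_mset M = m - i. \<Prod>k\<in>A. w k (count M k)))"
    by (subst sum.inter_filter) (auto intro!: sum.cong)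
  also have "\<dots> = (\<Sum>c | c * a \<le> m. w a c * (\<Sum>M\<in>B c. \<Prod>k\<in>A. w k (count M k)))"
    using a by (intro sum.reindex_bij_witness[of _ "\<lambda>c. c * a" "\<lambda>i. i div a"]) (auto simp: B_def)
  also have "\<dots> = (\<Sum>(c, M)\<in>Sigma {c. c * a \<le> m} B. w a c * (\<Prod>k\<in>A. w k (count M k)))"
  proof -
    have "finite {c. c * a \<le> m}"
    proof (rule finite_subset)
      show "{c. c * a \<le> m} \<subseteq> {..m}"
      proof
        fix c assume "c \<in> {c. c * a \<le> m}"
        moreover have "c \<le> c * a" using a by simp
        ultimately show "c \<in> {..m}" by (metis mem_Collect_eq atMost_iff order_trans)
      qed
    qed simp
    moreover have "finite (B c)" for c unfolding B_def using a by (intro finite_multisets_of_sum)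
    ultimately show ?thesis unfolding sum_distrib_left by (intro sum.Sigma) auto
  qed
  also have "\<dots> = (\<Sum>M | set_mset M \<subseteq> insert a A \<and> sum_mset M = m. \<Prod>k\<in>insert a A. w k (count M k))"
  proof (rule sum.reindex_bij_witness[of _ "\<lambda>M. (count M a, filter_mset (\<lambda>k. k \<noteq> a) M)"
        "\<lambda>(c, M). M + replicate_mset c a"], goal_cases)
    case (1 z)
    then show ?case using insert.hyps
      by (auto simp: B_def multiset_eq_iff subset_iff count_eq_zero_iff)
  next
    case (2 z)
    then show ?case using insert.hyps by (auto simp: B_def split: if_splits)
  next
    case (3 M)
    then show ?case by (auto simp: multiset_eq_iff)
  next
    case (4 M)
    have e: "M = filter_mset (\<lambda>k. k \<noteq> a) M + replicate_mset (count M a) a"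
      by (auto simp: multiset_eq_iff)
    have "sum_mset M = sum_mset (filter_mset (\<lambda>k. k \<noteq> a) M) + count M a * a"
      by (subst e) (simp only: sum_mset.union sum_mset_replicate_mset of_nat_id)
    with 4 show ?case by (auto simp: B_def)
  next
    case (5 z)
    obtain c M where z: "z = (c, M)" by force
    have "count M a = 0" using 5 z insert.hyps by (auto simp: B_def count_eq_zero_iff)
    moreover have "(\<Prod>k\<in>A. w k (count (M + replicate_mset c a) k)) = (\<Prod>k\<in>A. w k (count M k))"
      using insert.hyps by (intro prod.cong) auto
    ultimately show ?case using insert.hyps z by simp
  qed
  finally show ?case .
qed

text \<open>
  Multiplication by $1-q^k$ takes differences of the weights. The weights $1$, $c+1$ and $c$ are
  therefore reduced to a single monomial by one or two such multiplications.
\<close>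
lemma part_gf_mult_1_minus:
  assumes "k > 0"
  shows "part_gf v k * (1 - fps_X ^ k) = part_gf (\<lambda>c. v c - (if c = 0 then 0 else v (c - 1))) k"
proof (rule fps_ext)
  fix i
  show "fps_nth (part_gf v k * (1 - fps_X ^ k)) i = fps_nth (part_gf (\<lambda>c. v c - (if c = 0 then 0 else v (c - 1))) k) i"
  proof (cases "i < k")
    case True
    then show ?thesis using assms
      by (auto simp: right_diff_distrib fps_X_power_mult_right_nth part_gf_def dest: dvd_imp_le)
  next
    case False
    then obtain j where "i = j + k" by (metis add.commute le_Suc_ex not_le)
    then show ?thesis using assms
      by (auto simp: right_diff_distrib fps_X_power_mult_right_nth part_gf_def)
  qed
qed

lemma part_gf_delta: "k > 0 \<Longrightarrow> part_gf (\<lambda>c. if c = j then 1 else 0) k = fps_X ^ (j * k)"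
  by (rule fps_ext) (auto simp: part_gf_def)

lemma part_gf_1:
  assumes "k > 0"
  shows "part_gf (\<lambda>_. 1) k = inverse (1 - fps_X ^ k :: rat fps)"
proof -
  have "part_gf (\<lambda>_. 1 :: rat) k * (1 - fps_X ^ k) = part_gf (\<lambda>c. if c = 0 then 1 else 0) k"
    unfolding part_gf_mult_1_minus[OF assms] by (rule arg_cong2[of _ _ _ _ part_gf]) auto
  then have "part_gf (\<lambda>_. 1 :: rat) k * (1 - fps_X ^ k) = 1" using assms by (simp add: part_gf_delta)
  then show ?thesis using assms by (metis fps_inverse_unique mult.commute)
qed

lemma part_gf_Suc:
  assumes "k > 0"
  shows "part_gf (\<lambda>c. of_nat (c + 1)) k = (inverse (1 - fps_X ^ k :: rat fps))\<^sup>2"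
proof -
  have u: "(1 - fps_X ^ k :: rat fps) * inverse (1 - fps_X ^ k) = 1"
    using assms by (intro inverse_mult_eq_1') simp
  have "part_gf (\<lambda>c. of_nat (c + 1) :: rat) k * (1 - fps_X ^ k) = part_gf (\<lambda>_. 1) k"
    unfolding part_gf_mult_1_minus[OF assms]
    by (rule arg_cong2[of _ _ _ _ part_gf]) (auto simp: fun_eq_iff)
  then have "part_gf (\<lambda>c. of_nat (c + 1) :: rat) k * ((1 - fps_X ^ k) * inverse (1 - fps_X ^ k)) =
     inverse (1 - fps_X ^ k) * inverse (1 - fps_X ^ k)"
    using part_gf_1[OF assms] by (simp only: mult.assoc[symmetric])
  then show ?thesis unfolding u by (simp add: power2_eq_square)
qed

lemma part_gf_id:
  assumes "k > 0"
  shows "part_gf of_nat k = fps_X ^ k * (inverse (1 - fps_X ^ k :: rat fps))\<^sup>2"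
proof -
  have u: "(1 - fps_X ^ k :: rat fps) * inverse (1 - fps_X ^ k) = 1"
    using assms by (intro inverse_mult_eq_1') simp
  have "part_gf (of_nat :: nat \<Rightarrow> rat) k * (1 - fps_X ^ k) * (1 - fps_X ^ k) = part_gf (\<lambda>c. if c = 1 then 1 else 0) k"
    unfolding part_gf_mult_1_minus[OF assms]
    by (rule arg_cong2[of _ _ _ _ part_gf]) (auto simp: fun_eq_iff)
  then have "part_gf (of_nat :: nat \<Rightarrow> rat) k * ((1 - fps_X ^ k) * inverse (1 - fps_X ^ k)) * ((1 - fps_X ^ k) * inverse (1 - fps_X ^ k))
     = fps_X ^ k * (inverse (1 - fps_X ^ k))\<^sup>2"
    unfolding part_gf_delta[OF assms] by (simp add: power2_eq_square mult_ac)
  then show ?thesis unfolding u by simp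
qed

section \<open>Weighted partitions into odd parts\<close>

lemma odd_partitions_Max:
  assumes "M \<in> odd_partitions m" "m \<ge> 1"
  shows "Max (set_mset M) \<in># M" "odd (Max (set_mset M))" "Max (set_mset M) \<le> m"
proof -
  have "M \<noteq> {#}"
  proof
    assume "M = {#}"
    with assms show False by (simp add: odd_partitions_def)
  qed
  then show *: "Max (set_mset M) \<in># M" by (intro Max_in) simp_all
  then show "odd (Max (set_mset M))" using assms(1) unfolding odd_partitions_def by blast
  have "k \<le> sum_mset M" if "k \<in># M" for k using that by (auto dest!: multi_member_split)
  with * show "Max (set_mset M) \<le> m" using assms(1) unfolding odd_partitions_def by blast
qed

text \<open>
  The partitions are grouped by their largest part $2n+1$. The largest part has weight $c$ and every
  smaller odd size weight $c+1$; the latter is $1$ for $c=0$, so the product over the parts of a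
  partition extends to all odd sizes up to $2n+1$. The weight $c$ at $2n+1$ kills the partitions in
  which $2n+1$ does not occur.
\<close>
lemma p_lower_gf:
  assumes "m \<ge> 1" "m \<le> N"
  shows "of_nat (p_lower m) =
    fps_nth (\<Sum>n<N. fps_X ^ (2 * n + 1) * (\<Prod>i\<le>n. inverse (1 - fps_X ^ (2 * i + 1) :: rat fps))\<^sup>2) m"
proof -
  define A where "A n = (\<lambda>i::nat. 2 * i + 1) ` {..n}" for n :: nat
  define w :: "nat \<Rightarrow> nat \<Rightarrow> nat \<Rightarrow> rat"
    where "w n k = (if k = 2 * n + 1 then of_nat else (\<lambda>c. of_nat (c + 1)))" for n k
  define top where "top M = (Max (set_mset M) - 1) div 2" for M :: "nat multiset"
  have finite_odd: "finite (odd_partitions m)"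
    by (rule finite_subset[OF _ finite_multisets_of_sum[of "{k. odd k}" m]]) (auto simp: odd_partitions_def)
  have gf: "fps_X ^ (2 * n + 1) * (\<Prod>i\<le>n. inverse (1 - fps_X ^ (2 * i + 1) :: rat fps))\<^sup>2 =
      (\<Prod>k\<in>A n. part_gf (w n k) k)" for n
  proof -
    have "(\<Prod>k\<in>A n. part_gf (w n k) k) = (\<Prod>i\<le>n. part_gf (w n (2 * i + 1)) (2 * i + 1))"
      unfolding A_def by (subst prod.reindex) (auto simp: inj_on_def)
    also have "\<dots> = (\<Prod>i<n. part_gf (w n (2 * i + 1)) (2 * i + 1)) * part_gf (w n (2 * n + 1)) (2 * n + 1)"
      by (simp add: lessThan_Suc_atMost[symmetric])
    also have "(\<Prod>i<n. part_gf (w n (2 * i + 1)) (2 * i + 1)) = (\<Prod>i<n. (inverse (1 - fps_X ^ (2 * i + 1) :: rat fps))\<^sup>2)"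
      by (intro prod.cong refl, subst part_gf_Suc[symmetric]) (auto simp: w_def)
    also have "part_gf (w n (2 * n + 1)) (2 * n + 1) = fps_X ^ (2 * n + 1) * (inverse (1 - fps_X ^ (2 * n + 1) :: rat fps))\<^sup>2"
      by (subst part_gf_id[symmetric]) (auto simp: w_def)
    finally show ?thesis
      by (simp add: lessThan_Suc_atMost[symmetric] prod_power_distrib power_mult_distrib mult_ac del: power_Suc)
  qed
  have coeff: "fps_nth (\<Prod>k\<in>A n. part_gf (w n k) k) m =
      (\<Sum>M\<in>{M \<in> odd_partitions m. top M = n}. of_nat (\<Prod>k\<in>set_mset M. part_weight M k))" for n
  proof -
    have "fps_nth (\<Prod>k\<in>A n. part_gf (w n k) k) m =
        (\<Sum>M | set_mset M \<subseteq> A n \<and> sum_mset M = m. \<Prod>k\<in>A n. w n k (count M k))"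
      by (rule fps_nth_prod_part_gf) (auto simp: A_def)
    also have "\<dots> = (\<Sum>M\<in>{M \<in> odd_partitions m. top M = n}. of_nat (\<Prod>k\<in>set_mset M. part_weight M k))"
    proof (rule sum.mono_neutral_cong_right)
      show "finite {M. set_mset M \<subseteq> A n \<and> sum_mset M = m}"
        by (rule finite_multisets_of_sum) (auto simp: A_def)
      have max: "Max (set_mset M) = 2 * n + 1" "set_mset M \<subseteq> A n"
        if M: "M \<in> odd_partitions m" "top M = n" for M
      proof -
        have "odd (Max (set_mset M))" by (rule odd_partitions_Max(2)[OF M(1) assms(1)])
        then show *: "Max (set_mset M) = 2 * n + 1" using M(2) unfolding top_def by presburger
        show "set_mset M \<subseteq> A n"
        proof
          fix k assume "k \<in># M"
          then have "k \<le> Max (set_mset M)" "odd k" using M by (auto simp: odd_partitions_def)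
          then have "k \<le> 2 * n + 1" "odd k" using * by simp_all
          then show "k \<in> A n" unfolding A_def by (auto elim!: oddE)
        qed
      qed
      then show "{M \<in> odd_partitions m. top M = n} \<subseteq> {M. set_mset M \<subseteq> A n \<and> sum_mset M = m}"
        by (auto simp: odd_partitions_def)
      show "\<forall>M\<in>{M. set_mset M \<subseteq> A n \<and> sum_mset M = m} - {M \<in> odd_partitions m. top M = n}.
          (\<Prod>k\<in>A n. w n k (count M k)) = 0"
      proof
        fix M assume M: "M \<in> {M. set_mset M \<subseteq> A n \<and> sum_mset M = m} - {M \<in> odd_partitions m. top M = n}"
        have "2 * n + 1 \<notin># M"
        proof
          assume M2: "2 * n + 1 \<in># M"
          have "Max (set_mset M) = 2 * n + 1"
            using M by (intro Max_eqI M2) (auto simp: A_def)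
          then have "top M = n" by (simp add: top_def)
          with M show False by (auto simp: odd_partitions_def A_def)
        qed
        then have "w n (2 * n + 1) (count M (2 * n + 1)) = 0"
          by (simp add: w_def count_eq_zero_iff[THEN iffD2])
        then show "(\<Prod>k\<in>A n. w n k (count M k)) = 0"
          by (intro prod_zero bexI[of _ "2 * n + 1"]) (auto simp: A_def)
      qed
      fix M assume "M \<in> {M \<in> odd_partitions m. top M = n}"
      then have M0: "M \<in> odd_partitions m" "top M = n" by simp_all
      note M = max[OF M0]
      have "2 * n + 1 \<in># M" using odd_partitions_Max(1)[OF M0(1) assms(1)] by (simp only: M(1))
      then have "(\<Prod>k\<in>A n. w n k (count M k)) = (\<Prod>k\<in>set_mset M. w n k (count M k))"
      proof (intro prod.mono_neutral_right ballI)
        fix k assume "k \<in> A n - set_mset M"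
        moreover from this \<open>2 * n + 1 \<in># M\<close> have "k \<noteq> 2 * n + 1" by blast
        ultimately show "w n k (count M k) = 1" by (simp add: w_def count_eq_zero_iff)
      qed (use M in \<open>auto simp: A_def\<close>)
      also have "\<dots> = of_nat (\<Prod>k\<in>set_mset M. part_weight M k)"
        unfolding of_nat_prod by (intro prod.cong) (simp_all add: w_def part_weight_def M(1))
      finally show "(\<Prod>k\<in>A n. w n k (count M k)) = of_nat (\<Prod>k\<in>set_mset M. part_weight M k)" .
    qed
    finally show ?thesis .
  qed
  have "top M < N" if "M \<in> odd_partitions m" for M
    using odd_partitions_Max(3)[OF that assms(1)] assms by (auto simp: top_def)
  then have "(\<Sum>n<N. \<Sum>M\<in>{M \<in> odd_partitions m. top M = n}. of_nat (\<Prod>k\<in>set_mset M. part_weight M k) :: rat) =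
      (\<Sum>M\<in>odd_partitions m. of_nat (\<Prod>k\<in>set_mset M. part_weight M k))"
    by (intro sum.group finite_odd) auto
  then show ?thesis
    unfolding fps_sum_nth gf coeff by (simp add: p_lower_def)
qed

section \<open>Overpartitions with overlined even and small odd parts\<close>

lemma prod_1_plus_X_power:
  "finite B \<Longrightarrow> (\<Prod>i\<in>B. 1 + fps_X ^ i :: rat fps) = (\<Sum>S\<in>Pow B. fps_X ^ \<Sum>S)"
  using prod_add[of B "\<lambda>i. fps_X ^ i" "\<lambda>_. 1 :: rat fps"]
  by (simp only: power_sum prod.neutral_const mult_1_right add.commute[of 1])

text \<open>
  An overpartition is determined by the set $T$ of its overlined sizes and the multiset $U$ of its
  non-overlined parts. Under the conditions defining $p^*$ the smallest part $n$ must be overlined: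
  a non-overlined copy would be odd and at least $2n$, forcing $n=0$, which is even. Hence
  $T=\{n\}\cup S$ with $S$ a set of numbers above $n$, and $U$ is an arbitrary multiset of odd
  numbers $2i+1$ with $i\ge n$.
\<close>
lemma p_upper_set_bij:
  assumes "m < N"
  defines "Us \<equiv> \<lambda>n r. {U. set_mset U \<subseteq> (\<lambda>i::nat. 2 * i + 1) ` {n..<N} \<and> sum_mset U = r}"
  shows "bij_betw (\<lambda>(n, S, U). (mset_set (insert n S) + U, insert n S))
    (SIGMA n:{..<N}. SIGMA S:{S \<in> Pow {n+1..N}. n + \<Sum>S \<le> m}. Us n (m - (n + \<Sum>S))) (p_upper_set m)"
proof (rule bij_betw_byWitness[where f' = "\<lambda>(M, T). (Min T, T - {Min T}, M - mset_set T)"])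
  let ?X = "SIGMA n:{..<N}. SIGMA S:{S \<in> Pow {n+1..N}. n + \<Sum>S \<le> m}. Us n (m - (n + \<Sum>S))"
  have sum_mset_set: "sum_mset (mset_set T) = \<Sum>T" for T :: "nat set"
    by (simp add: sum_unfold_sum_mset)
  have low: "finite S" "Min (insert n S) = n" "n \<notin> S" if "S \<subseteq> {n+1..N}" for S and n :: nat
  proof -
    show "finite S" using that by (rule finite_subset) simp
    then show "Min (insert n S) = n" using that by (intro Min_eqI) auto
    show "n \<notin> S" using that by auto
  qed
  show "\<forall>x\<in>?X. (\<lambda>(M, T). (Min T, T - {Min T}, M - mset_set T)) ((\<lambda>(n, S, U). (mset_set (insert n S) + U, insert n S)) x) = x"
    using low by auto
  show "(\<lambda>(n, S, U). (mset_set (insert n S) + U, insert n S)) ` ?X \<subseteq> p_upper_set m"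
  proof
    fix x assume "x \<in> (\<lambda>(n, S, U). (mset_set (insert n S) + U, insert n S)) ` ?X"
    then obtain n S U where x: "x = (mset_set (insert n S) + U, insert n S)"
      and S: "S \<subseteq> {n+1..N}" and le: "n + \<Sum>S \<le> m" and U: "U \<in> Us n (m - (n + \<Sum>S))"
      by auto
    let ?T = "insert n S"
    have fin: "finite ?T" and nS: "n \<notin> S" using low[OF S] by auto
    have big: "odd k" "2 * n < k" if "k \<in># U" for k using U that by (auto simp: Us_def)
    have "Min (set_mset (mset_set ?T + U)) = n"
      using fin S by (intro Min_eqI) (auto dest: big(2))
    then have "smallest_part (mset_set ?T + U, ?T) = n" by (simp add: smallest_part_def)
    moreover have "non_overlined (mset_set ?T + U, ?T) = U" by (simp add: non_overlined_def)
    moreover have "sum_mset (mset_set ?T + U) = m"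
      using fin nS U le unfolding sum_mset.union sum_mset_set by (simp add: Us_def)
    moreover have "?T \<subseteq> set_mset (mset_set ?T + U)" "mset_set ?T + U \<noteq> {#}"
      using fin by (auto simp: mset_set_empty_iff)
    moreover have "\<not> even k" "\<not> (odd k \<and> k < 2 * n)" if "k \<in># U" for k
      using big[OF that] by auto
    ultimately show "x \<in> p_upper_set m"
      unfolding x by (simp add: p_upper_set_def overpartition_of_def)
  qed
  have invert: "T = insert (Min T) (T - {Min T}) \<and> mset_set T + (M - mset_set T) = M \<and>
      (Min T, T - {Min T}, M - mset_set T) \<in> ?X"
    if MT: "(M, T) \<in> p_upper_set m" for M T
  proof -
    define U where "U = M - mset_set T"
    define s where "s = Min (set_mset M)"
    have M: "sum_mset M = m" "T \<subseteq> set_mset M" "M \<noteq> {#}"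
      and U: "\<And>k. k \<in># U \<Longrightarrow> odd k \<and> 2 * s \<le> k"
      using MT by (auto simp: p_upper_set_def overpartition_of_def non_overlined_def smallest_part_def U_def s_def
          not_less)
    have fin: "finite T" using M(2) by (rule finite_subset) simp
    have "mset_set T \<subseteq># M"
      using M(2) fin by (intro mset_subset_eqI) (auto simp: count_mset_set' Suc_le_eq subset_iff)
    then have MU: "mset_set T + U = M" unfolding U_def by simp
    have "s \<in># M" unfolding s_def using M(3) by (intro Min_in) auto
    \<comment> \<open>An odd \<open>s\<close> with \<open>2 * s \<le> s\<close> is impossible.\<close>
    have "s \<notin># U" using U[of s] by (auto elim: oddE)
    with \<open>s \<in># M\<close> fin have sT: "s \<in> T" by (metis MU union_iff finite_set_mset_mset_set)
    have ge: "s \<le> k" if "k \<in> T" for k unfolding s_def using that M(2) by (intro Min_le) auto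
    have Min: "Min T = s" using sT ge fin by (intro Min_eqI) auto
    have sum: "s + \<Sum>(T - {s}) + sum_mset U = m"
      using M(1) fin sT unfolding MU[symmetric] sum_mset.union sum_mset_set by (simp add: sum.remove)
    have "k \<le> m" if "k \<in># M" for k using M(1) that by (auto dest!: multi_member_split)
    then have Tm: "k \<le> m" if "k \<in> T" for k using that M(2) by auto
    have Um: "k \<le> m" if "k \<in># U" for k using that sum by (auto dest!: multi_member_split)
    have "T - {s} \<subseteq> {s+1..N}"
    proof
      fix k assume "k \<in> T - {s}"
      then show "k \<in> {s+1..N}" using ge[of k] Tm[of k] assms(1) by auto
    qed
    moreover have "set_mset U \<subseteq> (\<lambda>i. 2 * i + 1) ` {s..<N}"
    proof
      fix k assume k: "k \<in># U"
      then have "odd k" using U by blast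
      then obtain i where "k = 2 * i + 1" by (rule oddE)
      then show "k \<in> (\<lambda>i. 2 * i + 1) ` {s..<N}" using U[OF k] Um[OF k] assms(1) by auto
    qed
    ultimately have "(s, T - {s}, U) \<in> ?X" using sum assms(1) by (auto simp: Us_def)
    then show ?thesis using MU sT unfolding Min U_def by auto
  qed
  show "\<forall>y\<in>p_upper_set m. (\<lambda>(n, S, U). (mset_set (insert n S) + U, insert n S)) ((\<lambda>(M, T). (Min T, T - {Min T}, M - mset_set T)) y) = y"
  proof
    fix y assume "y \<in> p_upper_set m"
    then obtain M T where y: "y = (M, T)" "(M, T) \<in> p_upper_set m" by (cases y) auto
    from invert[OF y(2)] have "insert (Min T) (T - {Min T}) = T" "mset_set T + (M - mset_set T) = M" by auto
    then show "(\<lambda>(n, S, U). (mset_set (insert n S) + U, insert n S)) ((\<lambda>(M, T). (Min T, T - {Min T}, M - mset_set T)) y) = y"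
      unfolding y by (simp only: prod.case)
  qed
  show "(\<lambda>(M, T). (Min T, T - {Min T}, M - mset_set T)) ` p_upper_set m \<subseteq> ?X"
  proof
    fix x assume "x \<in> (\<lambda>(M, T). (Min T, T - {Min T}, M - mset_set T)) ` p_upper_set m"
    then obtain M T where "x = (Min T, T - {Min T}, M - mset_set T)" "(M, T) \<in> p_upper_set m" by auto
    with invert show "x \<in> ?X" by simp
  qed
qed

lemma p_upper_gf:
  assumes "m < N"
  shows "of_nat (p_upper m) =
    fps_nth (\<Sum>n<N. fps_X ^ n * (\<Prod>i\<in>{n+1..N}. 1 + fps_X ^ i) *
       (\<Prod>i\<in>{n..<N}. inverse (1 - fps_X ^ (2 * i + 1) :: rat fps))) m"
proof -
  define Us where "Us = (\<lambda>n r. {U. set_mset U \<subseteq> (\<lambda>i::nat. 2 * i + 1) ` {n..<N} \<and> sum_mset U = r})"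
  define G where "G n = (\<Prod>i\<in>{n..<N}. inverse (1 - fps_X ^ (2 * i + 1) :: rat fps))" for n
  have G: "fps_nth (G n) r = of_nat (card (Us n r))" for n r
  proof -
    have "G n = (\<Prod>k\<in>(\<lambda>i. 2 * i + 1) ` {n..<N}. part_gf (\<lambda>_. 1) k)"
      unfolding G_def by (subst prod.reindex) (auto simp: inj_on_def part_gf_1 simp del: power_Suc)
    also have "fps_nth \<dots> r = of_nat (card (Us n r))"
      by (subst fps_nth_prod_part_gf) (auto simp: Us_def)
    finally show ?thesis .
  qed
  have finU: "finite (Us n r)" for n r unfolding Us_def by (rule finite_multisets_of_sum) auto
  have card_eq: "p_upper m = card (SIGMA n:{..<N}. SIGMA S:{S \<in> Pow {n+1..N}. n + \<Sum>S \<le> m}. Us n (m - (n + \<Sum>S)))"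
    unfolding p_upper_def Us_def by (rule bij_betw_same_card[OF p_upper_set_bij[OF assms], symmetric])
  have card_sum: "card (SIGMA n:{..<N}. SIGMA S:{S \<in> Pow {n+1..N}. n + \<Sum>S \<le> m}. Us n (m - (n + \<Sum>S))) =
      (\<Sum>n<N. \<Sum>S | S \<in> Pow {n+1..N} \<and> n + \<Sum>S \<le> m. card (Us n (m - (n + \<Sum>S))))"
  proof -
    define I where "I n = (SIGMA S:{S \<in> Pow {n+1..N}. n + \<Sum>S \<le> m}. Us n (m - (n + \<Sum>S)))" for n
    have fin: "finite (I n)" for n
      unfolding I_def using finU by (intro finite_SigmaI) auto
    have card: "card (I n) = (\<Sum>S | S \<in> Pow {n+1..N} \<and> n + \<Sum>S \<le> m. card (Us n (m - (n + \<Sum>S))))" for n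
      unfolding I_def using finU by (intro card_SigmaI) auto
    show ?thesis
      unfolding I_def[symmetric] card[symmetric] using fin by (intro card_SigmaI) auto
  qed
  have "of_nat (p_upper m) = (\<Sum>n<N. \<Sum>S\<in>Pow {n+1..N}. fps_nth (fps_X ^ (n + \<Sum>S) * G n) m)"
    unfolding card_eq card_sum of_nat_sum
  proof (rule sum.cong[OF refl])
    fix n assume "n \<in> {..<N}"
    show "(\<Sum>S | S \<in> Pow {n+1..N} \<and> n + \<Sum>S \<le> m. of_nat (card (Us n (m - (n + \<Sum>S))))) =
        (\<Sum>S\<in>Pow {n+1..N}. fps_nth (fps_X ^ (n + \<Sum>S) * G n) m)"
      by (rule sum.mono_neutral_cong_left) (auto simp: fps_X_power_mult_nth G)
  qed
  also have "\<dots> = fps_nth (\<Sum>n<N. fps_X ^ n * (\<Prod>i\<in>{n+1..N}. 1 + fps_X ^ i) * G n) m"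
  proof -
    have "fps_X ^ n * (\<Prod>i\<in>{n+1..N}. 1 + fps_X ^ i) * G n = (\<Sum>S\<in>Pow {n+1..N}. fps_X ^ (n + \<Sum>S) * G n)" for n
    proof -
      have "x * sum f A * y = (\<Sum>S\<in>A. x * f S * y)" for x y :: "rat fps" and f and A :: "nat set set"
        by (simp add: sum_distrib_left sum_distrib_right)
      then show ?thesis by (simp only: prod_1_plus_X_power[OF finite_atLeastAtMost] power_add)
    qed
    then show ?thesis by (simp only: fps_sum_nth)
  qed
  finally show ?thesis unfolding G_def .
qed

section \<open>Comparison of coefficients\<close>

lemma fps_to_fls_sum: "fps_to_fls (sum f A) = (\<Sum>x\<in>A. fps_to_fls (f x))"
  by (induction A rule: infinite_finite_induct) auto

lemma fps_to_fls_prod: "fps_to_fls (prod f A) = (\<Prod>x\<in>A. fps_to_fls (f x :: 'a::comm_semiring_1 fps))"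
  by (induction A rule: infinite_finite_induct) (auto simp: fls_times_fps_to_fls)

lemma fps_to_fls_inverse_1_minus:
  "fps_to_fls (inverse (1 - fps_X ^ (2 * i + 1) :: rat fps)) = inverse (1 - q * (q\<^sup>2) ^ i)"
proof -
  have "subdegree (1 - fps_X ^ (2 * i + 1) :: rat fps) = 0" by (rule subdegree_eq_0) simp
  note inv = fls_inverse_fps_to_fls[OF this]
  have e: "q * (q\<^sup>2) ^ i = q ^ (2 * i + 1)" by (simp add: power_mult)
  show ?thesis
    unfolding e inv[symmetric] fps_to_fls_minus fps_one_to_fls fps_to_fls_power fps_X_to_fls ..
qed

lemma odd_poch_conv: "odd_poch n = (\<Prod>i<n. 1 - q * (q\<^sup>2) ^ i)"
  by (simp add: odd_poch_def qpoch_def)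

lemma fls_p_lower_gf:
  assumes "m \<ge> 1" "m \<le> N"
  shows "of_nat (p_lower m) = (\<Sum>n<N. q ^ (2 * n + 1) / (odd_poch (Suc n))\<^sup>2) $$ int m"
proof -
  have "(\<Sum>n<N. q ^ (2 * n + 1) / (odd_poch (Suc n))\<^sup>2) =
     fps_to_fls (\<Sum>n<N. fps_X ^ (2 * n + 1) * (\<Prod>i\<le>n. inverse (1 - fps_X ^ (2 * i + 1) :: rat fps))\<^sup>2)"
    unfolding fps_to_fls_sum fls_times_fps_to_fls fps_to_fls_power fps_X_to_fls fps_to_fls_prod
      fps_to_fls_inverse_1_minus prod_inversef[unfolded comp_def] lessThan_Suc_atMost[symmetric] odd_poch_conv[symmetric]
    by (simp only: divide_inverse power_inverse)
  then show ?thesis using p_lower_gf[OF assms] by simp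
qed

lemma fls_p_upper_gf:
  assumes "m < N"
  shows "of_nat (p_upper m) =
    (\<Sum>n<N. q ^ n * (plus_poch N / plus_poch n) * (odd_poch n / odd_poch N)) $$ int m"
proof -
  have odd: "(\<Prod>i\<in>{n..<N}. inverse (1 - q * (q\<^sup>2) ^ i)) = odd_poch n / odd_poch N" if "n < N" for n
  proof -
    have "odd_poch N = odd_poch n * (\<Prod>i\<in>{n..<N}. 1 - q * (q\<^sup>2) ^ i)"
      unfolding odd_poch_conv lessThan_atLeast0 using that by (intro prod.atLeastLessThan_concat[symmetric]) auto
    then show ?thesis
      using odd_poch_nonzero[of N] odd_poch_nonzero[of n]
      unfolding prod_inversef[unfolded comp_def] by (simp add: field_simps)
  qed
  have plus: "(\<Prod>i\<in>{n+1..N}. 1 + q ^ i) = plus_poch N / plus_poch n" if "n < N" for n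
  proof -
    have c: "plus_poch k = (\<Prod>i\<in>{0..<k}. 1 + q ^ Suc i)" for k
      by (simp add: plus_poch_def qpoch_def lessThan_atLeast0)
    have "plus_poch N = plus_poch n * (\<Prod>i\<in>{n..<N}. 1 + q ^ Suc i)"
      unfolding c using that by (intro prod.atLeastLessThan_concat[symmetric]) auto
    also have "(\<Prod>i\<in>{n..<N}. 1 + q ^ Suc i) = (\<Prod>i\<in>{n+1..N}. 1 + q ^ i)"
      using prod.shift_bounds_Suc_ivl[of "\<lambda>i. 1 + q ^ i" n N] by (simp add: atLeastLessThanSuc_atLeastAtMost)
    finally show ?thesis by (simp add: field_simps)
  qed
  have "fps_to_fls (\<Sum>n<N. fps_X ^ n * (\<Prod>i\<in>{n+1..N}. 1 + fps_X ^ i) *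
       (\<Prod>i\<in>{n..<N}. inverse (1 - fps_X ^ (2 * i + 1) :: rat fps))) =
     (\<Sum>n<N. q ^ n * (\<Prod>i\<in>{n+1..N}. 1 + q ^ i) * (\<Prod>i\<in>{n..<N}. inverse (1 - q * (q\<^sup>2) ^ i)))"
    unfolding fps_to_fls_sum fls_times_fps_to_fls fps_to_fls_power fps_X_to_fls fps_to_fls_prod
      fps_to_fls_inverse_1_minus fps_to_fls_plus fps_one_to_fls ..
  also have "\<dots> = (\<Sum>n<N. q ^ n * (plus_poch N / plus_poch n) * (odd_poch n / odd_poch N))"
    by (intro sum.cong refl) (simp only: odd plus lessThan_iff)
  finally have "fps_nth (\<Sum>n<N. fps_X ^ n * (\<Prod>i\<in>{n+1..N}. 1 + fps_X ^ i) *
       (\<Prod>i\<in>{n..<N}. inverse (1 - fps_X ^ (2 * i + 1) :: rat fps))) m =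
     (\<Sum>n<N. q ^ n * (plus_poch N / plus_poch n) * (odd_poch n / odd_poch N)) $$ int m"
    by (drule_tac arg_cong[where f = "\<lambda>f. f $$ int m"])
       (simp only: fps_to_fls_nth of_nat_less_0_iff if_False nat_int)
  then show ?thesis using p_upper_gf[OF assms] by (simp only:)
qed

lemma false_theta_sum_nth:
  "false_theta_sum K $$ int n = (\<Sum>k<K. (-1) ^ k * (if n = 3 * k\<^sup>2 + 2 * k \<or> n = 3 * k\<^sup>2 + 4 * k + 1 then 1 else 0))"
proof -
  have "((-1) ^ k * q ^ (3 * k\<^sup>2 + 2 * k) * (1 + q ^ (2 * k + 1))) $$ int n =
     (-1) ^ k * (if n = 3 * k\<^sup>2 + 2 * k \<or> n = 3 * k\<^sup>2 + 4 * k + 1 then 1 else 0)" for k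
  proof -
    have "(-1) ^ k * q ^ (3 * k\<^sup>2 + 2 * k) * (1 + q ^ (2 * k + 1)) =
      fls_const ((-1) ^ k) * (q ^ (3 * k\<^sup>2 + 2 * k) + q ^ (3 * k\<^sup>2 + 4 * k + 1))"
      by (cases "even k") (simp_all add: algebra_simps power_add[symmetric])
    then show ?thesis by (simp only: fls_mult_const_nth fls_plus_nth fls_X_power_nth of_nat_eq_iff) auto
  qed
  then show ?thesis unfolding false_theta_sum_def fls_nth_sum by simp
qed

text \<open>
  For $j<k$ both exponents belonging to $j$ lie below both exponents belonging to $k$.
\<close>
lemma exponents_distinct:
  fixes j k :: nat
  assumes "n = 3 * j\<^sup>2 + 2 * j \<or> n = 3 * j\<^sup>2 + 4 * j + 1" "n = 3 * k\<^sup>2 + 2 * k \<or> n = 3 * k\<^sup>2 + 4 * k + 1"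
  shows "j = k"
proof -
  have "\<not> j < k" if "n = 3 * j\<^sup>2 + 2 * j \<or> n = 3 * j\<^sup>2 + 4 * j + 1" "n = 3 * k\<^sup>2 + 2 * k \<or> n = 3 * k\<^sup>2 + 4 * k + 1" for j k
  proof
    assume "j < k"
    then obtain d where d: "k = Suc (j + d)" using less_imp_Suc_add by auto
    from that show False unfolding d by (auto simp: power2_eq_square algebra_simps)
  qed
  from this[OF assms] this[OF assms(2,1)] show ?thesis by simp
qed

theorem theorem6p5:
  fixes n :: nat
  assumes "n \<ge> 1"
  shows "(\<forall>j::nat. n = 3 * j^2 + 2 * j \<or> n = 3 * j^2 + 4 * j + 1 \<longrightarrow>
            int (p_upper n) - 2 * int (p_lower n) = (-1) ^ j) \<and>
         ((\<nexists>j::nat. n = 3 * j^2 + 2 * j \<or> n = 3 * j^2 + 4 * j + 1) \<longrightarrow>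
            int (p_upper n) - 2 * int (p_lower n) = 0)"
proof -
  \<comment> \<open>Modulus \<open>n + 1\<close> reaches the coefficient \<open>n\<close>. The boundary terms with \<open>k < M\<close> involve
    products of length \<open>N - 2 * k\<close>, which must be at least \<open>M\<close>.\<close>
  define M N where "M = n + 1" and "N = 3 * M"
  let ?P = "\<lambda>j. n = 3 * j\<^sup>2 + 2 * j \<or> n = 3 * j\<^sup>2 + 4 * j + 1"
  have le: "j < M" if "?P j" for j
    using that self_le_power[of j 2] unfolding M_def by (cases "j = 0") auto
  have gf: "of_nat (p_upper n) - 2 * (of_nat (p_lower n) :: rat) = ((\<Sum>n<N. q ^ n * (plus_poch N / plus_poch n) * (odd_poch n / odd_poch N))
       - 2 * (\<Sum>n<N. q ^ (2 * n + 1) / (odd_poch (Suc n))\<^sup>2)) $$ int n"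
    (is "_ = (?U - 2 * ?L) $$ _")
  proof -
    have "n < N" "n \<le> N" by (simp_all add: N_def M_def)
    from fls_p_upper_gf[OF this(1)] fls_p_lower_gf[OF assms this(2)]
    show ?thesis by (simp only: fls_minus_nth mult_2 fls_plus_nth)
  qed
  have id: "(?U - 2 * ?L) $$ int n = false_theta_sum M $$ int n"
    by (rule eqmod_nth[OF generating_function_identity]) (auto simp: N_def M_def)
  have eq: "of_int (int (p_upper n) - 2 * int (p_lower n)) = (\<Sum>k<M. (-1) ^ k * (if ?P k then 1 else 0 :: rat))"
    unfolding of_int_diff of_int_mult of_int_numeral of_int_of_nat_eq gf id false_theta_sum_nth ..
  show ?thesis
  proof (intro conjI allI impI)
    fix j assume j: "?P j"
    have "(\<Sum>k<M. (-1) ^ k * (if ?P k then 1 else 0 :: rat)) = (\<Sum>k<M. if k = j then (-1) ^ j else 0)"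
    proof (rule sum.cong[OF refl])
      fix k
      show "(-1) ^ k * (if ?P k then 1 else 0 :: rat) = (if k = j then (-1) ^ j else 0)"
      proof (cases "k = j")
        case True
        show ?thesis unfolding True if_P[OF j] by simp
      next
        case False
        then have "\<not> ?P k" using exponents_distinct[OF j, of k] by blast
        then show ?thesis unfolding if_not_P[OF \<open>\<not> ?P k\<close>] using False by simp
      qed
    qed
    also have "\<dots> = of_int ((-1) ^ j)" using le[OF j] by simp
    finally show "int (p_upper n) - 2 * int (p_lower n) = (-1) ^ j" using eq by (metis of_int_eq_iff)
  next
    assume "\<nexists>j. ?P j"
    then have "(\<Sum>k<M. (-1) ^ k * (if ?P k then 1 else 0 :: rat)) = 0" by (intro sum.neutral) auto
    then show "int (p_upper n) - 2 * int (p_lower n) = 0" using eq by (metis of_int_eq_0_iff)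
  qed
qed

end
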